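(* Let $d\in\{2,3\}$, let $\Omega\subset\mathbb{R}^d$ be a bounded domain with Lipschitz boundary $\partial\Omega=\Gamma_D\cup\Gamma_N$, where $\Gamma_D$ and $\Gamma_N$ are disjoint and $\Gamma_D$ has positive surface measure; let $\mu>0$ and $\lambda\in\mathbb{R}$ with $2\mu+d\lambda>0$, and $\gamma=\mu\gamma_D$ with $\gamma_D>0$. Let $a(\cdot,\cdot)$, $f(\cdot)$ and $J(\cdot)$ be the bilinear form, linear form and modified energy functional on $H^1(\Omega)^d$ given in the context, and let $\mathcal M_N(l)\subset H^1(\Omega)^d$ be the set of $l$-layer neural network functions given in the context. Let $\boldsymbol u\in H^1(\Omega)^d$ be the solution of $$a(\boldsymbol u,\boldsymbol v)=f(\boldsymbol v)\quad\text{for all }\boldsymbol v\in H^1(\Omega)^d,$$ and let $\boldsymbol u_N\in\mathcal M_N(l)$ be a solution of $J(\boldsymbol u_N)=\min_{\boldsymbol v\in\mathcal M_N(l)}J(\boldsymbol v)$. Then $$\|\boldsymbol u-\boldsymbol u_N\|_a=\inf_{\boldsymbol v\in\mathcal M_N(l)}\|\boldsymbol u-\boldsymbol v\|_a,$$ where $\|\boldsymbol v\|_a:=\sqrt{a(\boldsymbol v,\boldsymbol v)}$.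
   Context: Forms. Let $\boldsymbol\varepsilon(\boldsymbol v)=\frac12(\nabla\boldsymbol v+(\nabla\boldsymbol v)^T)$. $\Gamma_D,\Gamma_N$ are measurable with respect to surface measure $dS$, and boundary values of $H^1$ functions are traces. Let $$\|\boldsymbol v\|_{1/2,\Gamma_D}=\left(\int_{\Gamma_D}|\boldsymbol v|^2\,dS+\int_{\Gamma_D}\int_{\Gamma_D}\frac{|\boldsymbol v(\boldsymbol x)-\boldsymbol v(\boldsymbol x')|^2}{d(\boldsymbol x,\boldsymbol x')^{d}}\,dS(\boldsymbol x)\,dS(\boldsymbol x')\right)^{1/2},$$ where $d(\boldsymbol x,\boldsymbol x')$ is the geodesic distance in $\Gamma_D$ (assumed measurable; $+\infty$, with integrand $0$, if the points cannot be joined within $\Gamma_D$) and the exponent $d$ is the space dimension; $(\cdot,\cdot)_{1/2,\Gamma_D}$ is the associated inner product. The data $\boldsymbol f$ and $\boldsymbol g_N$ are such that $\boldsymbol v\mapsto(\boldsymbol f,\boldsymbol v)$ and $\boldsymbol v\mapsto(\boldsymbol g_N,\boldsymbol v)_{0,\Gamma_N}$ ($L^2$ inner products on $\Omega$ and $\Gamma_N$ or their duality extensions) are bounded linear functionals on $H^1(\Omega)^d$, and $\|\boldsymbol g_D\|_{1/2,\Gamma_D}<\infty$. Define $$a(\boldsymbol u,\boldsymbol v)=2\mu(\boldsymbol\varepsilon(\boldsymbol u),\boldsymbol\varepsilon(\boldsymbol v))+\lambda(\nabla\cdot\boldsymbol u,\nabla\cdot\boldsymbol v)+\gamma(\boldsymbol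 u,\boldsymbol v)_{1/2,\Gamma_D},$$ $$f(\boldsymbol v)=(\boldsymbol f,\boldsymbol v)+(\boldsymbol g_N,\boldsymbol v)_{0,\Gamma_N}+\gamma(\boldsymbol g_D,\boldsymbol v)_{1/2,\Gamma_D},$$ $$J(\boldsymbol v)=\frac12\left\{\int_\Omega\left(2\mu|\boldsymbol\varepsilon(\boldsymbol v)|^2+\lambda|\nabla\cdot\boldsymbol v|^2\right)d\boldsymbol x+\gamma\|\boldsymbol v-\boldsymbol g_D\|^2_{1/2,\Gamma_D}\right\}-(\boldsymbol f,\boldsymbol v)-(\boldsymbol g_N,\boldsymbol v)_{0,\Gamma_N}.$$ Networks. Fix the number of layers $l\ge2$, hidden widths $n_1,\dots,n_{l-1}$ (encoded by the subscript $N$), $n_0=n_l=d$, and an activation function $\tau:\mathbb{R}\to\mathbb{R}$ acting componentwise. For $j=1,\dots,l-1$ let $N^{(j)}(\boldsymbol x^{(j-1)})=\tau(\boldsymbol\omega^{(j)}\boldsymbol x^{(j-1)}-\boldsymbol b^{(j)})$ for $\boldsymbol x^{(j-1)}\in\mathbb{R}^{n_{j-1}}$. Then $$\mathcal M_N(l)=\left\{\boldsymbol x\mapsto\boldsymbol\omega^{(l)}\left(N^{(l-1)}\circ\cdots\circ N^{(1)}(\boldsymbol x)\right)-\boldsymbol b^{(l)}:\ \boldsymbol\omega^{(j)}\in\mathbb{R}^{n_j\times n_{j-1}},\ \boldsymbol b^{(j)}\in\mathbb{R}^{n_j},\ 1\le j\le l\right\},$$ viewed as functions on $\Omega$. It is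 assumed that $\tau$ is such that $\mathcal M_N(l)\subset H^1(\Omega)^d$. This set is not in general a linear space, and the minimizer $\boldsymbol u_N$ need not be unique. *)

theory Defs
  imports "HOL-Analysis.Analysis"
begin

section \<open>Sobolev space \<open>H\<^sup>1\<close>\<close>

definition square_integrable :: "'a measure \<Rightarrow> ('a \<Rightarrow> 'b::euclidean_space) \<Rightarrow> bool" where
  "square_integrable M f \<longleftrightarrow> f \<in> borel_measurable M \<and> integrable M (\<lambda>x. (norm (f x))\<^sup>2)"

text \<open>\<open>D [j\<^sub>k, \<dots>, j\<^sub>1]\<close> is the iterated partial derivative of \<open>\<phi>\<close> in the directions
  \<open>j\<^sub>1\<close>, \dots, \<open>j\<^sub>k\<close>; each of them is required to be differentiable.\<close>

definition smooth :: "(real ^ 'n \<Rightarrow> real) \<Rightarrow> bool" where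
  "smooth \<phi> \<longleftrightarrow> (\<exists>D :: 'n list \<Rightarrow> real ^ 'n \<Rightarrow> real. D [] = \<phi> \<and>
     (\<forall>js x. (D js has_derivative (\<lambda>h. \<Sum>j\<in>UNIV. D (j # js) x * h $ j)) (at x)))"

definition test_functions :: "(real ^ 'n) set \<Rightarrow> (real ^ 'n \<Rightarrow> real) set" where
  "test_functions \<Omega> =
     {\<phi>. smooth \<phi> \<and> compact (closure {x. \<phi> x \<noteq> 0}) \<and> closure {x. \<phi> x \<noteq> 0} \<subseteq> \<Omega>}"

definition is_weak_jacobian ::
    "(real ^ 'n) set \<Rightarrow> (real ^ 'n \<Rightarrow> real ^ 'm) \<Rightarrow> (real ^ 'n \<Rightarrow> real ^ 'n ^ 'm) \<Rightarrow> bool" where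
  "is_weak_jacobian \<Omega> v G \<longleftrightarrow> (\<forall>\<phi>\<in>test_functions \<Omega>. \<forall>j.
     (LINT x|lebesgue_on \<Omega>. frechet_derivative \<phi> (at x) (axis j 1) *\<^sub>R v x) =
     - (LINT x|lebesgue_on \<Omega>. \<phi> x *\<^sub>R column j (G x)))"

text \<open>Elements of \<open>H1 \<Omega>\<close> are functions on the whole space; only their values on \<open>\<Omega>\<close> matter.\<close>

definition H1 :: "(real ^ 'n) set \<Rightarrow> (real ^ 'n \<Rightarrow> real ^ 'm) set" where
  "H1 \<Omega> = {v. square_integrable (lebesgue_on \<Omega>) v \<and>
     (\<exists>G. square_integrable (lebesgue_on \<Omega>) G \<and> is_weak_jacobian \<Omega> v G)}"

definition weak_jacobian ::
    "(real ^ 'n) set \<Rightarrow> (real ^ 'n \<Rightarrow> real ^ 'm) \<Rightarrow> real ^ 'n \<Rightarrow> real ^ 'n ^ 'm" where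
  "weak_jacobian \<Omega> v =
     (SOME G. square_integrable (lebesgue_on \<Omega>) G \<and> is_weak_jacobian \<Omega> v G)"

definition H1_norm :: "(real ^ 'n) set \<Rightarrow> (real ^ 'n \<Rightarrow> real ^ 'm) \<Rightarrow> real" where
  "H1_norm \<Omega> v = sqrt ((LINT x|lebesgue_on \<Omega>. (norm (v x))\<^sup>2) +
                        (LINT x|lebesgue_on \<Omega>. (norm (weak_jacobian \<Omega> v x))\<^sup>2))"

definition bounded_linear_functional_H1 ::
    "(real ^ 'n) set \<Rightarrow> ((real ^ 'n \<Rightarrow> real ^ 'm) \<Rightarrow> real) \<Rightarrow> bool" where
  "bounded_linear_functional_H1 \<Omega> F \<longleftrightarrow>
     (\<forall>v\<in>H1 \<Omega>. \<forall>w\<in>H1 \<Omega>. F (\<lambda>x. v x + w x) = F v + F w) \<and>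
     (\<forall>c. \<forall>v\<in>H1 \<Omega>. F (\<lambda>x. c *\<^sub>R v x) = c * F v) \<and>
     (\<exists>C. \<forall>v\<in>H1 \<Omega>. \<bar>F v\<bar> \<le> C * H1_norm \<Omega> v)"

section \<open>Lipschitz domains and surface measure\<close>

text \<open>Near each boundary point the domain is the part below a Lipschitz graph; \<open>e\<close> is the
  vertical direction, and \<open>\<psi>\<close> is a function of the \<open>d - 1\<close> coordinates orthogonal to \<open>e\<close>
  (extended constantly along \<open>e\<close>).\<close>

definition lipschitz_boundary :: "(real ^ 'n) set \<Rightarrow> bool" where
  "lipschitz_boundary \<Omega> \<longleftrightarrow> (\<forall>x\<in>frontier \<Omega>. \<exists>r>0. \<exists>e L. \<exists>\<psi> :: real ^ 'n \<Rightarrow> real.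
     norm e = 1 \<and> L-lipschitz_on UNIV \<psi> \<and> (\<forall>y t. \<psi> (y + t *\<^sub>R e) = \<psi> y) \<and>
     (\<forall>y\<in>ball x r. y \<in> \<Omega> \<longleftrightarrow> y \<bullet> e < \<psi> y))"

definition bounded_lipschitz_domain :: "(real ^ 'n) set \<Rightarrow> bool" where
  "bounded_lipschitz_domain \<Omega> \<longleftrightarrow>
     open \<Omega> \<and> connected \<Omega> \<and> \<Omega> \<noteq> {} \<and> bounded \<Omega> \<and> lipschitz_boundary \<Omega>"

text \<open>Hausdorff measure of integer dimension \<open>s \<ge> 1\<close>, normalised so that it agrees with
  \<open>s\<close>-dimensional Lebesgue measure on \<open>s\<close>-dimensional planes.  Its measurable sets are the
  Caratheodory-measurable ones, so it is complete.\<close>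

definition hausdorff_premeasure :: "nat \<Rightarrow> real \<Rightarrow> 'a::metric_space set \<Rightarrow> ennreal" where
  "hausdorff_premeasure s \<delta> A =
     (INF C\<in>{C :: nat \<Rightarrow> 'a set. A \<subseteq> (\<Union>i. C i) \<and> (\<forall>i. bounded (C i) \<and> diameter (C i) \<le> \<delta>)}.
        \<Sum>i. ennreal (unit_ball_vol (real s) * (diameter (C i) / 2) ^ s))"

definition hausdorff_outer :: "nat \<Rightarrow> 'a::metric_space set \<Rightarrow> ennreal" where
  "hausdorff_outer s A = (SUP \<delta>\<in>{0<..}. hausdorff_premeasure s \<delta> A)"

definition hausdorff_measure :: "nat \<Rightarrow> 'a::metric_space measure" where
  "hausdorff_measure s =
     measure_of UNIV (lambda_system UNIV UNIV (hausdorff_outer s)) (hausdorff_outer s)"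

lemma hausdorff_premeasure_empty: "s \<ge> 1 \<Longrightarrow> \<delta> > 0 \<Longrightarrow> hausdorff_premeasure s \<delta> {} = 0"
proof -
  assume "s \<ge> 1" "\<delta> > 0"
  then have "hausdorff_premeasure s \<delta> {} \<le>
      (\<Sum>i::nat. ennreal (unit_ball_vol (real s) * (diameter ({} :: 'a set) / 2) ^ s))"
    unfolding hausdorff_premeasure_def by (intro INF_lower2[where i = "\<lambda>_. {}"]) auto
  also have "\<dots> = 0" using \<open>s \<ge> 1\<close> by (simp add: power_0_left)
  finally show "hausdorff_premeasure s \<delta> ({} :: 'a set) = 0" by simp
qed

lemma hausdorff_premeasure_mono:
  "A \<subseteq> B \<Longrightarrow> hausdorff_premeasure s \<delta> A \<le> hausdorff_premeasure s \<delta> B"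
  unfolding hausdorff_premeasure_def by (intro INF_superset_mono) auto

lemma hausdorff_premeasure_UN:
  fixes A :: "nat \<Rightarrow> 'a::metric_space set"
  shows "hausdorff_premeasure s \<delta> (\<Union>i. A i) \<le> (\<Sum>i. hausdorff_premeasure s \<delta> (A i))"
proof (rule ennreal_le_epsilon)
  let ?w = "\<lambda>C :: 'a set. ennreal (unit_ball_vol (real s) * (diameter C / 2) ^ s)"
  fix e :: real assume fin: "(\<Sum>i. hausdorff_premeasure s \<delta> (A i)) < top" and e: "0 < e"
  have "\<exists>C. A i \<subseteq> (\<Union>j. C j) \<and> (\<forall>j. bounded (C j) \<and> diameter (C j) \<le> \<delta>) \<and>
      (\<Sum>j. ?w (C j)) < hausdorff_premeasure s \<delta> (A i) + ennreal (e * (1/2) ^ Suc i)" for i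
  proof -
    have "hausdorff_premeasure s \<delta> (A i) < top"
      using ennreal_suminf_lessD[OF fin] .
    moreover have "0 < ennreal (e * (1/2) ^ Suc i)" using e by simp
    ultimately have "hausdorff_premeasure s \<delta> (A i)
        < hausdorff_premeasure s \<delta> (A i) + ennreal (e * (1/2) ^ Suc i)"
      using ennreal_add_left_cancel_less[of "hausdorff_premeasure s \<delta> (A i)" 0] by simp
    then show ?thesis
      by (subst (asm) hausdorff_premeasure_def) (auto simp: INF_less_iff)
  qed
  then obtain C where C: "\<And>i. A i \<subseteq> (\<Union>j. C i j)" "\<And>i j. bounded (C i j)"
      "\<And>i j. diameter (C i j) \<le> \<delta>"
      "\<And>i. (\<Sum>j. ?w (C i j)) < hausdorff_premeasure s \<delta> (A i) + ennreal (e * (1/2) ^ Suc i)"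
    by metis
  define E where "E k = case_prod C (prod_decode k)" for k
  have "(\<Union>i. A i) \<subseteq> (\<Union>k. E k)"
  proof
    fix x assume "x \<in> (\<Union>i. A i)"
    then obtain i j where "x \<in> C i j" using C(1) by blast
    then have "x \<in> E (prod_encode (i, j))" by (simp add: E_def)
    then show "x \<in> (\<Union>k. E k)" by blast
  qed
  then have "hausdorff_premeasure s \<delta> (\<Union>i. A i) \<le> (\<Sum>k. ?w (E k))"
    unfolding hausdorff_premeasure_def using C(2,3)
    by (intro INF_lower) (auto simp: E_def split: prod.split)
  also have "\<dots> = (\<Sum>k. case_prod (\<lambda>i j. ?w (C i j)) (prod_decode k))"
    by (simp add: E_def split_beta)
  also have "\<dots> = (\<Sum>i. \<Sum>j. ?w (C i j))"
    by (subst suminf_ennreal_2dimen[symmetric]) (auto simp: comp_def)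
  also have "\<dots> \<le> (\<Sum>i. hausdorff_premeasure s \<delta> (A i) + ennreal (e * (1/2) ^ Suc i))"
    using C(4) by (intro suminf_le) (auto intro: less_imp_le)
  also have "\<dots> = (\<Sum>i. hausdorff_premeasure s \<delta> (A i)) + (\<Sum>i. ennreal (e * (1/2) ^ Suc i))"
    by (simp add: suminf_add)
  also have "(\<Sum>i. ennreal (e * (1/2) ^ Suc i)) = ennreal e"
    using e sums_mult[OF power_half_series, of e]
    by (subst suminf_ennreal_eq[where x = e]) auto
  finally show "hausdorff_premeasure s \<delta> (\<Union>i. A i)
      \<le> (\<Sum>i. hausdorff_premeasure s \<delta> (A i)) + ennreal e" .
qed

lemma outer_measure_space_hausdorff_outer:
  assumes "s \<ge> 1"
  shows "outer_measure_space UNIV (hausdorff_outer s :: 'a::metric_space set \<Rightarrow> ennreal)"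
  unfolding outer_measure_space_def
proof (intro conjI)
  show "positive UNIV (hausdorff_outer s :: 'a set \<Rightarrow> ennreal)"
    using assms by (auto simp: positive_def hausdorff_outer_def hausdorff_premeasure_empty)
  show "increasing UNIV (hausdorff_outer s :: 'a set \<Rightarrow> ennreal)"
    by (auto simp: increasing_def hausdorff_outer_def intro!: SUP_mono' hausdorff_premeasure_mono)
  show "countably_subadditive UNIV (hausdorff_outer s :: 'a set \<Rightarrow> ennreal)"
    unfolding countably_subadditive_def
  proof (intro allI impI)
    fix A :: "nat \<Rightarrow> 'a set"
    show "hausdorff_outer s (\<Union>i. A i) \<le> (\<Sum>i. hausdorff_outer s (A i))"
      unfolding hausdorff_outer_def
    proof (intro SUP_least)
      fix \<delta> :: real assume "\<delta> \<in> {0<..}"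
      then show "hausdorff_premeasure s \<delta> (\<Union>i. A i)
          \<le> (\<Sum>i. SUP \<delta>\<in>{0<..}. hausdorff_premeasure s \<delta> (A i))"
        by (intro order_trans[OF hausdorff_premeasure_UN] suminf_le SUP_upper) auto
    qed
  qed
qed

lemma emeasure_hausdorff_measure:
  assumes "s \<ge> 1" "A \<in> sets (hausdorff_measure s)"
  shows "emeasure (hausdorff_measure s) A = hausdorff_outer s (A :: 'a::metric_space set)"
proof -
  let ?L = "lambda_system UNIV UNIV (hausdorff_outer s :: 'a set \<Rightarrow> ennreal)"
  interpret sigma_algebra "UNIV :: 'a set" UNIV
    using sigma_algebra_Pow[of "UNIV :: 'a set"] by simp
  have ms: "measure_space UNIV ?L (hausdorff_outer s)"
    using caratheodory_lemma[OF outer_measure_space_hausdorff_outer[OF assms(1)]] by simp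
  then have "sigma_algebra UNIV ?L" by (simp add: measure_space_def)
  then have "sets (hausdorff_measure s) = ?L"
    unfolding hausdorff_measure_def by (simp add: sigma_algebra.sigma_sets_eq)
  then show ?thesis
    using assms(2) ms unfolding hausdorff_measure_def
    by (intro emeasure_measure_of_sigma) (auto simp: measure_space_def)
qed

definition surface_measure :: "(real ^ 'n) set \<Rightarrow> (real ^ 'n) measure" where
  "surface_measure \<Gamma> = restrict_space (hausdorff_measure (CARD('n) - 1)) \<Gamma>"

section \<open>Geodesic distance and \<open>H\<^sup>1\<^sup>/\<^sup>2\<close> inner products\<close>

definition curve_length :: "(real \<Rightarrow> 'a::metric_space) \<Rightarrow> ennreal" where
  "curve_length g =
     (SUP (k, t)\<in>{(k :: nat, t :: nat \<Rightarrow> real). mono_on {..k} t \<and> t ` {..k} \<subseteq> {0..1}}.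
        \<Sum>i<k. ennreal (dist (g (t i)) (g (t (Suc i)))))"

text \<open>Infinite if no rectifiable curve in \<open>\<Gamma>\<close> joins the two points.\<close>

definition geodesic_dist :: "'a::metric_space set \<Rightarrow> 'a \<Rightarrow> 'a \<Rightarrow> ennreal" where
  "geodesic_dist \<Gamma> x y =
     (INF g\<in>{g. path g \<and> path_image g \<subseteq> \<Gamma> \<and> pathstart g = x \<and> pathfinish g = y}. curve_length g)"

text \<open>The Sobolev--Slobodeckij space and inner product of order 1/2 on a \<open>(d - 1)\<close>-dimensional
  set \<open>\<Gamma>\<close>, with respect to a distance \<open>\<rho>\<close> on \<open>\<Gamma>\<close> that may take the value \<open>\<infinity>\<close>.  On the diagonal,
  which is a null set for \<open>d \<ge> 2\<close>, the kernel is 0 because of \<open>1 / 0 = 0\<close>.\<close>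

definition half_kernel :: "(real ^ 'n \<Rightarrow> real ^ 'n \<Rightarrow> ennreal) \<Rightarrow> real ^ 'n \<Rightarrow> real ^ 'n \<Rightarrow> real" where
  "half_kernel \<rho> x y = (if \<rho> x y = \<infinity> then 0 else 1 / enn2real (\<rho> x y) ^ CARD('n))"

definition H_half ::
    "(real ^ 'n \<Rightarrow> real ^ 'n \<Rightarrow> ennreal) \<Rightarrow> (real ^ 'n) set \<Rightarrow> (real ^ 'n \<Rightarrow> real ^ 'm) set" where
  "H_half \<rho> \<Gamma> = {v. square_integrable (surface_measure \<Gamma>) v \<and>
     integrable (surface_measure \<Gamma> \<Otimes>\<^sub>M surface_measure \<Gamma>)
       (\<lambda>(x, y). (norm (v x - v y))\<^sup>2 * half_kernel \<rho> x y)}"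

definition half_inner ::
    "(real ^ 'n \<Rightarrow> real ^ 'n \<Rightarrow> ennreal) \<Rightarrow> (real ^ 'n) set \<Rightarrow>
     (real ^ 'n \<Rightarrow> real ^ 'm) \<Rightarrow> (real ^ 'n \<Rightarrow> real ^ 'm) \<Rightarrow> real" where
  "half_inner \<rho> \<Gamma> v w =
     (LINT x|surface_measure \<Gamma>. v x \<bullet> w x) +
     (LINT (x, y)|(surface_measure \<Gamma> \<Otimes>\<^sub>M surface_measure \<Gamma>).
        ((v x - v y) \<bullet> (w x - w y)) * half_kernel \<rho> x y)"

definition half_norm ::
    "(real ^ 'n \<Rightarrow> real ^ 'n \<Rightarrow> ennreal) \<Rightarrow> (real ^ 'n) set \<Rightarrow> (real ^ 'n \<Rightarrow> real ^ 'm) \<Rightarrow> real" where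
  "half_norm \<rho> \<Gamma> v = sqrt (
     (LINT x|surface_measure \<Gamma>. (norm (v x))\<^sup>2) +
     (LINT (x, y)|(surface_measure \<Gamma> \<Otimes>\<^sub>M surface_measure \<Gamma>).
        (norm (v x - v y))\<^sup>2 * half_kernel \<rho> x y))"

text \<open>The trace operator \<open>H\<^sup>1(\<Omega>) \<rightarrow> H\<^sup>1\<^sup>/\<^sup>2(\<partial>\<Omega>)\<close> of a bounded Lipschitz domain: the bounded linear
  operator that restricts functions continuous up to the boundary to \<open>\<partial>\<Omega>\<close>.  It exists by the
  trace theorem, and by density it is unique up to null sets.  Here \<open>H\<^sup>1\<^sup>/\<^sup>2(\<partial>\<Omega>)\<close> carries the usual norm,
  with the Euclidean distance.\<close>

definition euclidean_dist :: "'a::metric_space \<Rightarrow> 'a \<Rightarrow> ennreal" where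
  "euclidean_dist x y = ennreal (dist x y)"

definition trace_operator ::
    "(real ^ 'n) set \<Rightarrow> ((real ^ 'n \<Rightarrow> real ^ 'm) \<Rightarrow> (real ^ 'n \<Rightarrow> real ^ 'm)) \<Rightarrow> bool" where
  "trace_operator \<Omega> T \<longleftrightarrow>
     (\<forall>v\<in>H1 \<Omega>. T v \<in> H_half euclidean_dist (frontier \<Omega>)) \<and>
     (\<forall>v\<in>H1 \<Omega>. \<forall>w\<in>H1 \<Omega>. AE x in surface_measure (frontier \<Omega>).
        T (\<lambda>y. v y + w y) x = T v x + T w x) \<and>
     (\<forall>c. \<forall>v\<in>H1 \<Omega>. AE x in surface_measure (frontier \<Omega>). T (\<lambda>y. c *\<^sub>R v y) x = c *\<^sub>R T v x) \<and>
     (\<exists>C. \<forall>v\<in>H1 \<Omega>. half_norm euclidean_dist (frontier \<Omega>) (T v) \<le> C * H1_norm \<Omega> v) \<and>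
     (\<forall>v\<in>H1 \<Omega>. continuous_on (closure \<Omega>) v \<longrightarrow>
        (AE x in surface_measure (frontier \<Omega>). T v x = v x))"

section \<open>Elasticity forms\<close>

definition strain :: "(real ^ 'n) set \<Rightarrow> (real ^ 'n \<Rightarrow> real ^ 'n) \<Rightarrow> real ^ 'n \<Rightarrow> real ^ 'n ^ 'n" where
  "strain \<Omega> v x = (1 / 2) *\<^sub>R (weak_jacobian \<Omega> v x + transpose (weak_jacobian \<Omega> v x))"

definition divergence :: "(real ^ 'n) set \<Rightarrow> (real ^ 'n \<Rightarrow> real ^ 'n) \<Rightarrow> real ^ 'n \<Rightarrow> real" where
  "divergence \<Omega> v x = (\<Sum>i\<in>UNIV. weak_jacobian \<Omega> v x $ i $ i)"

text \<open>The inner product and norm on \<^typ>\<open>real ^ 'n ^ 'n\<close> are the Frobenius ones.  In the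
  following, \<open>T\<close> is the trace operator.\<close>

definition bilinear_a where
  "bilinear_a \<Omega> \<Gamma>\<^sub>D T \<mu> lam \<gamma> v w =
     2 * \<mu> * (LINT x|lebesgue_on \<Omega>. strain \<Omega> v x \<bullet> strain \<Omega> w x) +
     lam * (LINT x|lebesgue_on \<Omega>. divergence \<Omega> v x * divergence \<Omega> w x) +
     \<gamma> * half_inner (geodesic_dist \<Gamma>\<^sub>D) \<Gamma>\<^sub>D (T v) (T w)"

definition norm_a where
  "norm_a \<Omega> \<Gamma>\<^sub>D T \<mu> lam \<gamma> v = sqrt (bilinear_a \<Omega> \<Gamma>\<^sub>D T \<mu> lam \<gamma> v v)"

text \<open>The volume load enters through the functional \<open>f = (f, \<cdot>)\<close> on \<open>H\<^sup>1(\<Omega>)\<^sup>d\<close>, the boundary load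
  through the functional \<open>g\<^sub>N = (g\<^sub>N, \<cdot>)\<close> on boundary values.\<close>

definition linear_f where
  "linear_f \<Gamma>\<^sub>D T \<gamma> f g\<^sub>N g\<^sub>D v =
     f v + g\<^sub>N (T v) + \<gamma> * half_inner (geodesic_dist \<Gamma>\<^sub>D) \<Gamma>\<^sub>D g\<^sub>D (T v)"

definition energy_J where
  "energy_J \<Omega> \<Gamma>\<^sub>D T \<mu> lam \<gamma> f g\<^sub>N g\<^sub>D v =
     1 / 2 * ((LINT x|lebesgue_on \<Omega>.
                 2 * \<mu> * (norm (strain \<Omega> v x))\<^sup>2 + lam * \<bar>divergence \<Omega> v x\<bar>\<^sup>2) +
              \<gamma> * (half_norm (geodesic_dist \<Gamma>\<^sub>D) \<Gamma>\<^sub>D (\<lambda>x. T v x - g\<^sub>D x))\<^sup>2)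
     - f v - g\<^sub>N (T v)"

section \<open>Neural networks\<close>

text \<open>Vectors in \<open>\<real>\<^sup>n\<close> for the layer widths \<open>n\<close> are functions on \<open>nat\<close>, of which only the values
  at \<open>i < n\<close> are used; the coordinates of \<^typ>\<open>real ^ 'n\<close> are numbered by the bijection
  \<^term>\<open>to_nat_on UNIV\<close> from \<open>'n\<close> to \<open>{..<CARD('n)}\<close>.  The weights and biases of layer \<open>j \<ge> 1\<close> are
  \<open>\<omega> j\<close> and \<open>b j\<close>, and \<open>hidden_layer \<tau> n \<omega> b j\<close> is \<open>N\<^sup>(\<^sup>j\<^sup>) \<circ> \<dots> \<circ> N\<^sup>(\<^sup>1\<^sup>)\<close>.\<close>

definition affine_layer ::
    "(nat \<Rightarrow> nat) \<Rightarrow> (nat \<Rightarrow> nat \<Rightarrow> nat \<Rightarrow> real) \<Rightarrow> (nat \<Rightarrow> nat \<Rightarrow> real) \<Rightarrow>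
     nat \<Rightarrow> (nat \<Rightarrow> real) \<Rightarrow> nat \<Rightarrow> real" where
  "affine_layer n \<omega> b j y i = (\<Sum>k<n (j - 1). \<omega> j i k * y k) - b j i"

primrec hidden_layer ::
    "(real \<Rightarrow> real) \<Rightarrow> (nat \<Rightarrow> nat) \<Rightarrow> (nat \<Rightarrow> nat \<Rightarrow> nat \<Rightarrow> real) \<Rightarrow> (nat \<Rightarrow> nat \<Rightarrow> real) \<Rightarrow>
     nat \<Rightarrow> (nat \<Rightarrow> real) \<Rightarrow> nat \<Rightarrow> real" where
  "hidden_layer \<tau> n \<omega> b 0 y = y"
| "hidden_layer \<tau> n \<omega> b (Suc j) y =
     (\<lambda>i. \<tau> (affine_layer n \<omega> b (Suc j) (hidden_layer \<tau> n \<omega> b j y) i))"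

definition coords :: "real ^ 'n::finite \<Rightarrow> nat \<Rightarrow> real" where
  "coords x k = x $ from_nat_into UNIV k"

definition network ::
    "(real \<Rightarrow> real) \<Rightarrow> nat \<Rightarrow> (nat \<Rightarrow> nat) \<Rightarrow> (nat \<Rightarrow> nat \<Rightarrow> nat \<Rightarrow> real) \<Rightarrow> (nat \<Rightarrow> nat \<Rightarrow> real) \<Rightarrow>
     real ^ 'n::finite \<Rightarrow> real ^ 'n" where
  "network \<tau> l n \<omega> b x =
     (\<chi> i. affine_layer n \<omega> b l (hidden_layer \<tau> n \<omega> b (l - 1) (coords x)) (to_nat_on UNIV i))"

definition network_functions ::
    "(real \<Rightarrow> real) \<Rightarrow> nat \<Rightarrow> (nat \<Rightarrow> nat) \<Rightarrow> (real ^ 'n::finite \<Rightarrow> real ^ 'n) set" where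
  "network_functions \<tau> l n = {network \<tau> l n \<omega> b | \<omega> b. True}"

end

theory Submission
  imports Defs
begin

text \<open>The energy is a shifted square: since \<open>u\<close> solves \<open>a(u, v) = f(v)\<close>, expanding
  \<open>a(u - v, u - v)\<close> gives \<open>2 J(v) + C\<close> with a constant \<open>C\<close> independent of \<open>v \<in> H\<^sup>1\<close>, so a
  minimiser of \<open>J\<close> over any subset of \<open>H\<^sup>1\<close> is a best approximation of \<open>u\<close> there.  The work lies in
  justifying the expansion.  Weak Jacobians are chosen by \<open>SOME\<close>, so their linearity requires
  uniqueness, i.e. the fundamental lemma of the calculus of variations.  The boundary term must be
  finite for traces: the geodesic distance dominates the Euclidean one, and the surface measure of
  the boundary is finite because the trace of a nonzero constant is square integrable.\<close>

section \<open>Smooth bump functions\<close>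

text \<open>The Bochner integral of a non-integrable function is 0, so an integral of a sum may be
  split only when the summands are integrable; hence every term of the form must first be placed in
  some L^2 space. Moreover \<open>weak_jacobian\<close> and \<open>T\<close> respect differences
  only almost everywhere, so the expansion of a square is proved for a function that equals the
  difference off a null set. For the double boundary integral this null set has to be lifted to a
  product, which calls for sigma-finite factors; the ambient Hausdorff measure of codimension one is
  not sigma-finite, and finiteness on the boundary repairs this. The constant that witnesses this
  finiteness belongs to \<open>H1\<close> because partial derivatives of test functions integrate to
  0. Finally, \<open>smooth\<close> demands a family of all iterated partial derivatives, so bump
  functions are drawn from an explicit algebra closed under differentiation.\<close>

definition flat_exp :: "nat \<Rightarrow> real \<Rightarrow> real" where
  "flat_exp m t = (if t > 0 then exp (- 1 / t) / t ^ m else 0)"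

text \<open>A single term of the exponential series bounds exp(1/t) from below, so exp(-1/t) beats
  every negative power of t near 0; the order m + k leaves a factor t^k after division by
  t^m.\<close>

lemma flat_exp_le:
  assumes "t > 0"
  shows "flat_exp m t \<le> fact (m + k) * t ^ k"
proof -
  have "(1 / t) ^ (m + k) / fact (m + k) \<le> exp (1 / t)"
    using assms sums_le[OF _ sums_single[of "m + k" "\<lambda>i. (1 / t) ^ i / fact i"] exp_converges[of "1 / t"]]
    by (auto simp: divide_inverse ac_simps)
  then have "exp (- 1 / t) \<le> fact (m + k) * t ^ (m + k)"
    using assms by (simp add: exp_minus field_simps power_divide)
  then show ?thesis
    using assms by (simp add: flat_exp_def field_simps power_add)
qed

text \<open>The exponent \<open>m\<close> is carried along because differentiating exp(-1/t)/t^m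
  raises it, by 2 from the exponential and by 1 from the power; every higher derivative is again a
  combination of members of the family.\<close>

lemma flat_exp_has_derivative:
  "(flat_exp m has_real_derivative flat_exp (m + 2) t - real m * flat_exp (m + 1) t) (at t)"
proof -
  consider "t > 0" | "t < 0" | "t = 0" by linarith
  then show ?thesis
  proof cases
    case 1
    have e: "((\<lambda>s. exp (- 1 / s)) has_real_derivative exp (- 1 / t) / t ^ 2) (at t)"
      using 1 by (auto intro!: derivative_eq_intros simp: power2_eq_square)
    have p: "((\<lambda>s. s ^ m) has_real_derivative real m * t ^ (m - 1)) (at t)"
      by (auto intro!: derivative_eq_intros)
    \<comment> \<open>Truncated subtraction in \<open>m - 1\<close> matters only for m = 0, where
      the factor \<open>real m\<close> vanishes.\<close>
    have m: "real m * t ^ (m - 1) = real m * t ^ m / t"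
      using 1 by (cases m) auto
    have "((\<lambda>s. exp (- 1 / s) / s ^ m) has_real_derivative
        flat_exp (m + 2) t - real m * flat_exp (m + 1) t) (at t)"
    proof (rule DERIV_cong[OF DERIV_divide[OF e p]])
      show "(exp (- 1 / t) / t\<^sup>2 * t ^ m - exp (- 1 / t) * (real m * t ^ (m - 1))) / (t ^ m * t ^ m) =
          flat_exp (m + 2) t - real m * flat_exp (m + 1) t"
        unfolding m using 1 by (simp add: flat_exp_def field_simps power2_eq_square)
    qed (use 1 in simp)
    then show ?thesis
      by (rule has_field_derivative_transform_within_open[where S = "{0<..}"]) (use 1 in \<open>auto simp: flat_exp_def\<close>)
  next
    case 2
    have "((\<lambda>s. 0) has_real_derivative flat_exp (m + 2) t - real m * flat_exp (m + 1) t) (at t)"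
      using 2 by (simp add: flat_exp_def)
    then show ?thesis
      by (rule has_field_derivative_transform_within_open[where S = "{..<0}"]) (use 2 in \<open>auto simp: flat_exp_def\<close>)
  next
    case 3
    have "((\<lambda>h. flat_exp m h / h) \<longlongrightarrow> 0) (at 0)"
    \<comment> \<open>With k = 2 in \<open>flat_exp_le\<close> one power of |h| survives the
      division by h.\<close>
    proof (rule Lim_null_comparison[where g = "\<lambda>h. fact (m + 2) * \<bar>h\<bar>"])
      have "norm (flat_exp m h / h) \<le> fact (m + 2) * \<bar>h\<bar>" if "h \<noteq> 0" for h
      proof (cases "h > 0")
        case True
        then have "0 \<le> flat_exp m h" by (simp add: flat_exp_def)
        then show ?thesis
          using flat_exp_le[OF True, of m 2] True by (simp add: divide_le_eq power2_eq_square mult.assoc)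
      next
        case False
        then have "flat_exp m h = 0" by (simp add: flat_exp_def)
        then show ?thesis by simp
      qed
      then show "\<forall>\<^sub>F h in at 0. norm (flat_exp m h / h) \<le> fact (m + 2) * \<bar>h\<bar>"
        by (auto simp: eventually_at_filter)
      show "((\<lambda>h. fact (m + 2) * \<bar>h\<bar>) \<longlongrightarrow> 0) (at (0::real))"
        by (auto intro!: tendsto_eq_intros)
    qed
    then show ?thesis
      using 3 by (simp add: DERIV_def flat_exp_def[of _ 0])
  qed
qed

text \<open>An algebra of functions that is closed under partial derivatives and contains bump functions.\<close>

inductive flat_algebra :: "(real ^ 'n \<Rightarrow> real) \<Rightarrow> bool" where
  flat: "flat_algebra (\<lambda>x. flat_exp m (c * x $ i + d))"
| const: "flat_algebra (\<lambda>x. c)"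
| add: "flat_algebra f \<Longrightarrow> flat_algebra g \<Longrightarrow> flat_algebra (\<lambda>x. f x + g x)"
| mult: "flat_algebra f \<Longrightarrow> flat_algebra g \<Longrightarrow> flat_algebra (\<lambda>x. f x * g x)"

text \<open>The partial derivatives are returned inside the algebra so that the statement can be
  iterated.\<close>

lemma flat_algebra_partial:
  fixes f :: "real ^ 'n \<Rightarrow> real"
  assumes "flat_algebra f"
  shows "\<exists>p. (\<forall>j. flat_algebra (p j)) \<and>
           (\<forall>x. (f has_derivative (\<lambda>h. \<Sum>j\<in>UNIV. p j x * h $ j)) (at x))"
  using assms
proof induction
  case (flat m c i d)
  \<comment> \<open>The factor c is the chain rule; the minus sign sits in a constant factor because
    the algebra has no subtraction.\<close>
  define q where "q x = c * (flat_exp (m + 2) (c * x $ i + d) + (- real m) * flat_exp (m + 1) (c * x $ i + d))"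
    for x :: "real ^ 'n"
  have "flat_algebra q"
    unfolding q_def by (intro flat_algebra.intros)
  then have "flat_algebra (if j = i then q else (\<lambda>x. 0))" for j
    by (simp add: flat_algebra.const)
  moreover have "((\<lambda>x. flat_exp m (c * x $ i + d)) has_derivative
      (\<lambda>h. \<Sum>j\<in>UNIV. (if j = i then q else (\<lambda>x. 0)) x * h $ j)) (at x)" for x
  proof -
    have "(\<lambda>h. \<Sum>j\<in>UNIV. (if j = i then q else (\<lambda>x. 0)) x * h $ j) = (\<lambda>h. q x * h $ i)"
      by (simp add: if_distrib[of "\<lambda>q. q * _"] if_distribR cong: if_cong)
    moreover have "((\<lambda>x. c * x $ i + d) has_derivative (\<lambda>h. c * h $ i)) (at x)"
      by (auto intro!: derivative_eq_intros bounded_linear_imp_has_derivative bounded_linear_vec_nth)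
    from DERIV_compose_FDERIV[OF flat_exp_has_derivative this]
    have "((\<lambda>x. flat_exp m (c * x $ i + d)) has_derivative (\<lambda>h. q x * h $ i)) (at x)"
      by (simp add: q_def algebra_simps)
    ultimately show ?thesis by simp
  qed
  ultimately show ?case
    by (intro exI[of _ "\<lambda>j. if j = i then q else (\<lambda>x. 0)"] conjI allI)
next
  case (const c)
  show ?case
    by (rule exI[of _ "\<lambda>j x. 0"]) (auto intro: flat_algebra.const)
next
  case (add f g)
  from add.IH obtain p q where "\<forall>j. flat_algebra (p j)" "\<forall>j. flat_algebra (q j)"
    "\<And>x. (f has_derivative (\<lambda>h. \<Sum>j\<in>UNIV. p j x * h $ j)) (at x)"
    "\<And>x. (g has_derivative (\<lambda>h. \<Sum>j\<in>UNIV. q j x * h $ j)) (at x)"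
    by blast
  then show ?case
    by (intro exI[of _ "\<lambda>j x. p j x + q j x"])
      (auto intro!: flat_algebra.add derivative_eq_intros simp: distrib_right sum.distrib)
next
  case (mult f g)
  from mult.IH obtain p q where "\<forall>j. flat_algebra (p j)" "\<forall>j. flat_algebra (q j)"
    "\<And>x. (f has_derivative (\<lambda>h. \<Sum>j\<in>UNIV. p j x * h $ j)) (at x)"
    "\<And>x. (g has_derivative (\<lambda>h. \<Sum>j\<in>UNIV. q j x * h $ j)) (at x)"
    by blast
  then show ?case
    using mult.hyps
    by (intro exI[of _ "\<lambda>j x. f x * q j x + p j x * g x"])
      (auto intro!: flat_algebra.add flat_algebra.mult derivative_eq_intros
        simp: sum.distrib sum_distrib_left sum_distrib_right algebra_simps)
qed

lemma smooth_flat_algebra: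
  fixes f :: "real ^ 'n \<Rightarrow> real"
  assumes "flat_algebra f"
  shows "smooth f"
proof -
  obtain p :: "(real ^ 'n \<Rightarrow> real) \<Rightarrow> 'n \<Rightarrow> real ^ 'n \<Rightarrow> real"
    where p: "\<And>g j. flat_algebra g \<Longrightarrow> flat_algebra (p g j)"
      "\<And>g x. flat_algebra g \<Longrightarrow> (g has_derivative (\<lambda>h. \<Sum>j\<in>UNIV. p g j x * h $ j)) (at x)"
    using flat_algebra_partial by metis
  \<comment> \<open>As in \<open>smooth\<close>, the last derivative taken is at the head of the
    list, so \<open>D (j # js)\<close> is \<open>p (D js) j\<close>.\<close>
  define D where "D js = foldr (\<lambda>j g. p g j) js f" for js
  have "flat_algebra (D js)" for js
    by (induction js) (auto simp: D_def assms p(1))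
  then have "(D js has_derivative (\<lambda>h. \<Sum>j\<in>UNIV. D (j # js) x * h $ j)) (at x)" for js x
    using p(2)[of "D js" x] by (simp add: D_def)
  moreover have "D [] = f" by (simp add: D_def)
  ultimately show ?thesis unfolding smooth_def by blast
qed

lemma smooth_imp_continuous_on:
  assumes "smooth f"
  shows "continuous_on S f"
proof -
  obtain D where "D [] = f"
    "\<And>js x. (D js has_derivative (\<lambda>h. \<Sum>j\<in>UNIV. D (j # js) x * h $ j)) (at x)"
    using assms unfolding smooth_def by blast
  then show ?thesis
    using has_derivative_continuous by (blast intro: continuous_at_imp_continuous_on)
qed

text \<open>For c > 0 this is positive exactly on the open box, and with growing c it increases to
  the indicator of that box.\<close>

definition box_bump :: "real ^ 'n \<Rightarrow> real ^ 'n \<Rightarrow> real \<Rightarrow> real ^ 'n \<Rightarrow> real" where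
  "box_bump a b c x =
     (\<Prod>i\<in>UNIV. flat_exp 0 (c * (x $ i - a $ i)) * flat_exp 0 (c * (b $ i - x $ i)))"

lemma flat_exp_0_bounds: "0 \<le> flat_exp 0 t" "flat_exp 0 t \<le> 1"
  by (auto simp: flat_exp_def)

lemma flat_algebra_prod:
  "finite I \<Longrightarrow> (\<And>i. i \<in> I \<Longrightarrow> flat_algebra (f i)) \<Longrightarrow> flat_algebra (\<lambda>x. \<Prod>i\<in>I. f i x)"
  by (induction I rule: finite_induct) (auto intro: flat_algebra.const flat_algebra.mult)

lemma smooth_box_bump: "smooth (box_bump a b c)"
proof -
  \<comment> \<open>Both factors are brought into the form \<open>c * x $ i + d\<close> of the
    generator \<open>flat\<close>, the second one with slope -c.\<close>
  have eq: "box_bump a b c = (\<lambda>x. \<Prod>i\<in>UNIV. flat_exp 0 (c * x $ i + (- c * a $ i)) *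
      flat_exp 0 ((- c) * x $ i + c * b $ i))"
    by (simp add: fun_eq_iff box_bump_def algebra_simps)
  show ?thesis
    unfolding eq
    by (intro smooth_flat_algebra flat_algebra_prod flat_algebra.mult flat_algebra.flat) simp
qed

lemma box_bump_bounds: "0 \<le> box_bump a b c x" "box_bump a b c x \<le> 1"
  unfolding box_bump_def
  by (auto intro!: prod_nonneg prod_le_1 mult_le_one mult_nonneg_nonneg flat_exp_0_bounds)

lemma box_bump_outside:
  assumes "c > 0" "x \<notin> box a b"
  shows "box_bump a b c x = 0"
proof -
  obtain i where "x $ i \<le> a $ i \<or> b $ i \<le> x $ i"
    using assms(2) by (auto simp: mem_box_cart not_less)
  then have "flat_exp 0 (c * (x $ i - a $ i)) * flat_exp 0 (c * (b $ i - x $ i)) = 0"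
    using assms(1) by (auto simp: flat_exp_def zero_less_mult_iff)
  then show ?thesis
    unfolding box_bump_def by (intro prod_zero) auto
qed

lemma box_bump_test_function:
  assumes "c > 0" "cbox a b \<subseteq> \<Omega>"
  shows "box_bump a b c \<in> test_functions \<Omega>"
proof -
  have "{x. box_bump a b c x \<noteq> 0} \<subseteq> cbox a b"
    using box_bump_outside[OF assms(1)] box_subset_cbox by blast
  then have "closure {x. box_bump a b c x \<noteq> 0} \<subseteq> cbox a b"
    by (intro closure_minimal closed_cbox)
  moreover from this have "compact (closure {x. box_bump a b c x \<noteq> 0})"
    using bounded_subset[OF bounded_cbox] by (auto simp: compact_eq_bounded_closed)
  ultimately show ?thesis
    using assms(2) smooth_box_bump unfolding test_functions_def by blast
qed

text \<open>Each factor exp(-1/((k+1)t)) with t > 0 tends to exp(0) = 1, and outside the box every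
  term is 0. The shift to \<open>Suc k\<close> keeps the scaling positive.\<close>

lemma box_bump_tendsto: "(\<lambda>k. box_bump a b (real (Suc k)) x) \<longlonglongrightarrow> indicator (box a b) x"
proof (cases "x \<in> box a b")
  case True
  have *: "(\<lambda>k. flat_exp 0 (real (Suc k) * t)) \<longlonglongrightarrow> 1" if "t > 0" for t :: real
  proof -
    have "(\<lambda>k. exp (- (inverse (real (Suc k)) * inverse t))) \<longlonglongrightarrow> exp (- (0 * inverse t))"
      by (intro tendsto_intros LIMSEQ_inverse_real_of_nat)
    moreover have "exp (- (inverse (real (Suc k)) * inverse t)) = flat_exp 0 (real (Suc k) * t)" for k
      using that by (simp add: flat_exp_def divide_inverse del: of_nat_Suc)
    ultimately show ?thesis by simp
  qed
  have "(\<lambda>k. box_bump a b (real (Suc k)) x) \<longlonglongrightarrow> (\<Prod>i\<in>(UNIV :: 'a set). 1 * 1)"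
    unfolding box_bump_def using True
    by (intro tendsto_intros *) (auto simp: mem_box_cart)
  then show ?thesis using True by simp
next
  case False
  then show ?thesis by (simp add: box_bump_outside del: of_nat_Suc)
qed

section \<open>The fundamental lemma of the calculus of variations\<close>

text \<open>Open boxes form an intersection-stable generator of the Borel sets, and the Borel sets
  over which g integrates to 0 form a Dynkin system.\<close>

lemma integral_box_zero_imp_integral_zero:
  fixes g :: "real ^ 'n \<Rightarrow> 'b::euclidean_space"
  assumes g: "integrable lebesgue g"
    and zero: "\<And>a b. (LINT x|lebesgue. indicator (box a b) x *\<^sub>R g x) = 0"
    and A: "A \<in> sets borel"
  shows "(LINT x|lebesgue. indicator A x *\<^sub>R g x) = 0"
proof -
  let ?G = "range (\<lambda>(a, b). box a b :: (real ^ 'n) set)"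
  have int: "integrable lebesgue (\<lambda>x. indicator B x *\<^sub>R g x)" if "B \<in> sets borel" for B
    using that g by (intro integrable_mult_indicator) (auto intro: sets_completionI_sets)
  have G: "sigma_sets UNIV ?G = sets borel"
    by (simp add: borel_eq_box)
  have "Int_stable ?G"
    by (auto simp: Int_stable_def box_Int_box)
  moreover have "?G \<subseteq> Pow UNIV" by simp
  moreover have "A \<in> sigma_sets UNIV ?G" using A G by simp
  ultimately show ?thesis
  proof (induction rule: sigma_sets_induct_disjoint)
    case (basic B)
    then show ?case using zero by auto
  next
    case empty
    then show ?case by simp
  next
    case (compl B)
    \<comment> \<open>The complement step subtracts from the integral over the whole space, which is
      not a box; by dominated convergence it is the limit over the boxes (-k, k)^n.\<close>
    have whole: "(LINT x|lebesgue. g x) = 0"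
    proof (rule LIMSEQ_unique)
      show "(\<lambda>k. LINT x|lebesgue. indicator (box (\<chi> i. - real k) (\<chi> i. real k)) x *\<^sub>R g x)
          \<longlonglongrightarrow> (LINT x|lebesgue. g x)"
      proof (rule integral_dominated_convergence[where w = "\<lambda>x. norm (g x)"])
        show "AE x in lebesgue. (\<lambda>k. indicator (box (\<chi> i. - real k) (\<chi> i. real k)) x *\<^sub>R g x) \<longlonglongrightarrow> g x"
        proof (rule AE_I2)
          fix x :: "real ^ 'n"
          obtain K where K: "norm x < real K" using reals_Archimedean2 by blast
          have "x \<in> box (\<chi> i. - real k) (\<chi> i. real k)" if "k \<ge> K" for k
            using K that component_le_norm_cart[of x]
            by (auto simp: mem_box_cart) (smt (verit) of_nat_mono)+
          then have "\<forall>\<^sub>F k in sequentially.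
              indicator (box (\<chi> i. - real k) (\<chi> i. real k)) x *\<^sub>R g x = g x"
            unfolding eventually_sequentially by (intro exI[of _ K]) simp
          then show "(\<lambda>k. indicator (box (\<chi> i. - real k) (\<chi> i. real k)) x *\<^sub>R g x) \<longlonglongrightarrow> g x"
            by (rule tendsto_eventually)
        qed
        show "(\<lambda>x. indicator (box (\<chi> i. - real k) (\<chi> i. real k)) x *\<^sub>R g x)
            \<in> borel_measurable lebesgue" for k
          by (intro borel_measurable_integrable int) simp
      qed (use g in \<open>auto simp: indicator_def\<close>)
      show "(\<lambda>k. LINT x|lebesgue. indicator (box (\<chi> i. - real k) (\<chi> i. real k)) x *\<^sub>R g x)
          \<longlonglongrightarrow> 0"
        by (simp add: zero)
    qed
    have "(LINT x|lebesgue. indicator (UNIV - B) x *\<^sub>R g x) =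
        (LINT x|lebesgue. g x - indicator B x *\<^sub>R g x)"
      by (intro Bochner_Integration.integral_cong) (auto simp: indicator_def)
    also have "\<dots> = 0"
      using compl G whole g int by (subst Bochner_Integration.integral_diff) auto
    finally show ?case .
  next
    case (union B)
    have B: "B i \<in> sets borel" for i using union(2) G by auto
    have "(LINT x:(\<Union>i. B i)|lebesgue. g x) = (\<Sum>i. (LINT x:(B i)|lebesgue. g x))"
      using B union(1) int
      by (intro lebesgue_integral_countable_add)
        (auto simp: disjoint_family_on_def set_integrable_def intro: sets_completionI_sets)
    then show ?case
      using union(3) by (simp add: set_lebesgue_integral_def)
  qed
qed

text \<open>Boxes control only Borel sets, while \<open>density_zero\<close> quantifies over
  Lebesgue sets; the two differ by subsets of null sets, which do not change integrals.\<close>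

lemma integral_box_zero_imp_AE_zero:
  fixes g :: "real ^ 'n \<Rightarrow> 'b::euclidean_space"
  assumes g: "integrable lebesgue g"
    and zero: "\<And>a b. (LINT x|lebesgue. indicator (box a b) x *\<^sub>R g x) = 0"
  shows "AE x in lebesgue. g x = 0"
proof -
  \<comment> \<open>Sigma-finiteness passes from \<open>lborel\<close> to its completion with the
    same countable cover.\<close>
  interpret sigma_finite_measure "lebesgue :: (real ^ 'n) measure"
  proof
    obtain A :: "(real ^ 'n) set set" where "countable A" "A \<subseteq> sets lborel" "\<Union>A = space lborel"
      "\<forall>a\<in>A. emeasure lborel a \<noteq> \<infinity>"
      using sigma_finite_lborel unfolding sigma_finite_measure_def by blast
    then show "\<exists>A :: (real ^ 'n) set set. countable A \<and> A \<subseteq> sets lebesgue \<and> \<Union>A = space lebesgue \<and>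
        (\<forall>a\<in>A. emeasure lebesgue a \<noteq> (\<infinity>::ennreal))"
      by (intro exI[of _ A]) (auto intro: sets_completionI_sets)
  qed
  show ?thesis
  proof (rule density_zero[OF g])
    fix A :: "(real ^ 'n) set" assume "A \<in> sets lebesgue"
    then obtain S N N' where A: "A = S \<union> N" "N \<subseteq> N'" "N' \<in> null_sets lborel" "S \<in> sets lborel"
      by (rule sets_completionE)
    have "AE x in lebesgue. x \<notin> N'"
      using A(3) by (intro AE_completion AE_not_in)
    then have "AE x in lebesgue. indicator A x *\<^sub>R g x = indicator S x *\<^sub>R g x"
      by eventually_elim (use A in \<open>auto simp: indicator_def\<close>)
    then have "(LINT x|lebesgue. indicator A x *\<^sub>R g x) = (LINT x|lebesgue. indicator S x *\<^sub>R g x)"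
      using \<open>A \<in> sets lebesgue\<close> A(4) g
      by (intro integral_cong_AE borel_measurable_integrable integrable_mult_indicator)
        (auto intro: sets_completionI_sets)
    also have "\<dots> = 0"
      using A(4) by (intro integral_box_zero_imp_integral_zero[OF g zero]) simp
    finally show "(LINT x:A|lebesgue. g x) = 0"
      by (simp add: set_lebesgue_integral_def)
  qed
qed

text \<open>Bump functions converge boundedly to the indicator of an open box whose closed box lies
  in the domain, so g integrates to 0 over such boxes; countably many of them cover the
  domain.\<close>

lemma fundamental_lemma_calculus_of_variations:
  fixes g :: "real ^ 'n \<Rightarrow> 'b::euclidean_space"
  assumes "open \<Omega>" and g: "integrable (lebesgue_on \<Omega>) g"
    and zero: "\<And>\<phi>. \<phi> \<in> test_functions \<Omega> \<Longrightarrow> (LINT x|lebesgue_on \<Omega>. \<phi> x *\<^sub>R g x) = 0"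
  shows "AE x in lebesgue_on \<Omega>. g x = 0"
proof -
  have \<Omega>: "\<Omega> \<in> sets lebesgue" using assms(1) by auto
  have box: "(LINT x|lebesgue. indicator (box a b) x *\<^sub>R g x) = 0" if ab: "cbox a b \<subseteq> \<Omega>" for a b
  proof -
    have "box a b \<subseteq> \<Omega>" using ab box_subset_cbox by blast
    have "(\<lambda>k. LINT x|lebesgue_on \<Omega>. box_bump a b (real (Suc k)) x *\<^sub>R g x)
        \<longlonglongrightarrow> (LINT x|lebesgue_on \<Omega>. indicator (box a b) x *\<^sub>R g x)"
    proof (rule integral_dominated_convergence[where w = "\<lambda>x. norm (g x)"])
      show "AE x in lebesgue_on \<Omega>. (\<lambda>k. box_bump a b (real (Suc k)) x *\<^sub>R g x)
          \<longlonglongrightarrow> indicator (box a b) x *\<^sub>R g x"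
        by (intro AE_I2 tendsto_intros box_bump_tendsto)
      show "AE x in lebesgue_on \<Omega>. norm (box_bump a b (real (Suc k)) x *\<^sub>R g x) \<le> norm (g x)" for k
        by (intro AE_I2) (simp add: box_bump_bounds mult_left_le_one_le del: of_nat_Suc)
      have "continuous_on UNIV (box_bump a b c)" for c
        by (rule smooth_imp_continuous_on[OF smooth_box_bump])
      then have [measurable]: "box_bump a b c \<in> borel_measurable (lebesgue_on \<Omega>)" for c
        by (intro measurable_restrict_space1 measurable_completion) (simp add: borel_measurable_continuous_onI)
      have [measurable]: "g \<in> borel_measurable (lebesgue_on \<Omega>)" using g by simp
      show "(\<lambda>x. box_bump a b (real (Suc k)) x *\<^sub>R g x) \<in> borel_measurable (lebesgue_on \<Omega>)" for k
        by measurable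
      have [measurable]: "(indicator (box a b) :: _ \<Rightarrow> real) \<in> borel_measurable (lebesgue_on \<Omega>)"
        by (intro measurable_restrict_space1 measurable_completion) simp
      show "(\<lambda>x. indicator (box a b) x *\<^sub>R g x) \<in> borel_measurable (lebesgue_on \<Omega>)"
        by measurable
    qed (use g in auto)
    moreover have "(LINT x|lebesgue_on \<Omega>. box_bump a b (real (Suc k)) x *\<^sub>R g x) = 0" for k
      by (intro zero box_bump_test_function ab) simp
    ultimately have "(LINT x|lebesgue_on \<Omega>. indicator (box a b) x *\<^sub>R g x) = 0"
      using LIMSEQ_unique[OF _ tendsto_const] by (simp del: of_nat_Suc)
    moreover have "(LINT x|lebesgue_on \<Omega>. indicator (box a b) x *\<^sub>R g x) =
        (LINT x|lebesgue. indicator \<Omega> x *\<^sub>R indicator (box a b) x *\<^sub>R g x)"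
      using \<Omega> by (subst integral_restrict_space) auto
    moreover have "\<dots> = (LINT x|lebesgue. indicator (box a b) x *\<^sub>R g x)"
      using \<open>box a b \<subseteq> \<Omega>\<close> by (intro Bochner_Integration.integral_cong) (auto simp: indicator_def)
    ultimately show ?thesis by simp
  qed
  \<comment> \<open>Cutting g off outside \<open>box c d\<close> gives a function integrable on the
    whole space; its integral over any box is an integral of g over an intersection of two boxes,
    again a box inside the domain.\<close>
  have AE_box: "AE x in lebesgue. x \<in> box c d \<longrightarrow> g x = 0" if cd: "cbox c d \<subseteq> \<Omega>" for c d
  proof -
    have "integrable lebesgue (\<lambda>x. indicator \<Omega> x *\<^sub>R g x)"
      using g \<Omega> by (simp add: integrable_restrict_space)
    then have "integrable lebesgue (\<lambda>x. indicator (box c d) x *\<^sub>R indicator \<Omega> x *\<^sub>R g x)"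
      by (rule integrable_mult_indicator[rotated]) simp
    moreover have "(\<lambda>x. indicator (box c d) x *\<^sub>R indicator \<Omega> x *\<^sub>R g x) = (\<lambda>x. indicator (box c d) x *\<^sub>R g x)"
      using cd box_subset_cbox[of c d] by (auto simp: indicator_def fun_eq_iff)
    ultimately have "integrable lebesgue (\<lambda>x. indicator (box c d) x *\<^sub>R g x)" by (simp only:)
    moreover have "(LINT x|lebesgue. indicator (box a b) x *\<^sub>R indicator (box c d) x *\<^sub>R g x) = 0" for a b
    proof -
      obtain a' b' where ab': "box a b \<inter> box c d = box a' b'"
        using box_Int_box by blast
      have "indicator (box a b) x *\<^sub>R indicator (box c d) x *\<^sub>R g x = indicator (box a' b') x *\<^sub>R g x" for x
        using ab' by (auto simp: indicator_def)
      moreover have "(LINT x|lebesgue. indicator (box a' b') x *\<^sub>R g x) = 0"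
      \<comment> \<open>If the open box is empty, \<open>cbox a' b'\<close> may still be a nonempty
        degenerate box leaving the domain; the closure argument is reserved for the nonempty
        case.\<close>
      proof (cases "box a' b' = {}")
        case False
        then have "cbox a' b' = closure (box a' b')" by simp
        also have "\<dots> \<subseteq> cbox c d"
          using ab' box_subset_cbox by (intro closure_minimal closed_cbox) blast
        finally have "cbox a' b' \<subseteq> cbox c d" .
        then show ?thesis using cd by (intro box) auto
      qed simp
      ultimately show ?thesis by (simp only:)
    qed
    ultimately have "AE x in lebesgue. indicator (box c d) x *\<^sub>R g x = 0"
      by (intro integral_box_zero_imp_AE_zero)
    then show ?thesis by eventually_elim (auto simp: indicator_def)
  qed
  \<comment> \<open>Countability of the cover lets the exceptional null sets be united.\<close>
  obtain \<D> where D: "countable \<D>" "\<And>B. B \<in> \<D> \<Longrightarrow> \<exists>c d. B = box c d \<and> cbox c d \<subseteq> \<Omega>" "\<Union>\<D> = \<Omega>"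
  proof -
    define \<C> where "\<C> = {box c d | c d. cbox c d \<subseteq> \<Omega>}"
    have "\<Union>\<C> = \<Omega>"
    proof
      show "\<Union>\<C> \<subseteq> \<Omega>"
        using box_subset_cbox unfolding \<C>_def by blast
      show "\<Omega> \<subseteq> \<Union>\<C>"
      proof
        fix x assume "x \<in> \<Omega>"
        then obtain c d where "cbox c d \<subseteq> \<Omega>" "x \<in> box c d"
          using open_contains_cbox[OF assms(1)] by blast
        then show "x \<in> \<Union>\<C>" unfolding \<C>_def by blast
      qed
    qed
    moreover have "\<And>S. S \<in> \<C> \<Longrightarrow> open S" unfolding \<C>_def by auto
    ultimately obtain \<D> where "\<D> \<subseteq> \<C>" "countable \<D>" "\<Union>\<D> = \<Omega>"
      using Lindelof[of \<C>] by blast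
    then show ?thesis using that[of \<D>] unfolding \<C>_def by blast
  qed
  have "AE x in lebesgue. \<forall>B\<in>\<D>. x \<in> B \<longrightarrow> g x = 0"
    using D(1,2) AE_box by (subst AE_ball_countable) blast+
  then have "AE x in lebesgue. x \<in> \<Omega> \<longrightarrow> g x = 0"
    by eventually_elim (use D(3) in auto)
  then show ?thesis
    using \<Omega> by (subst AE_restrict_space_iff) auto
qed

section \<open>Test functions\<close>

text \<open>Weak Jacobians are tested with \<open>frechet_derivative\<close>, whereas
  \<open>smooth\<close> only provides an abstract family \<open>D\<close>. Uniqueness of the
  derivative identifies the two, and the partial derivatives are continuous because
  \<open>D [j]\<close> is itself differentiable.\<close>

lemma test_function_partial:
  assumes "\<phi> \<in> test_functions \<Omega>"
  shows "(\<phi> has_derivative frechet_derivative \<phi> (at x)) (at x)" (is ?diff)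
    and "continuous_on UNIV \<phi>" (is ?cont)
    and "continuous_on UNIV (\<lambda>x. frechet_derivative \<phi> (at x) (axis j 1))" (is ?cont')
proof -
  obtain D :: "'a list \<Rightarrow> real ^ 'a \<Rightarrow> real" where D: "D [] = \<phi>"
    "\<And>js x. (D js has_derivative (\<lambda>h. \<Sum>j\<in>UNIV. D (j # js) x * h $ j)) (at x)"
    using assms unfolding test_functions_def smooth_def by blast
  have cont: "continuous_on UNIV (D js)" for js
    using D(2) has_derivative_continuous by (blast intro: continuous_at_imp_continuous_on)
  have fd: "frechet_derivative \<phi> (at x) = (\<lambda>h. \<Sum>j\<in>UNIV. D [j] x * h $ j)" for x
    using frechet_derivative_at[OF D(2)[of "[]"]] D(1) by simp
  then have "frechet_derivative \<phi> (at x) (axis j 1) = D [j] x" for x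
    by (simp add: axis_def if_distrib[of "\<lambda>c. _ * c"] cong: if_cong)
  then show ?cont' using cont[of "[j]"] by simp
  show ?cont using cont[of "[]"] D(1) by simp
  show ?diff using D(2)[of "[]"] D(1) fd by simp
qed

lemma test_function_outside:
  assumes "\<phi> \<in> test_functions \<Omega>" "x \<notin> closure {x. \<phi> x \<noteq> 0}"
  shows "\<phi> x = 0" "frechet_derivative \<phi> (at x) = (\<lambda>h. 0)"
proof -
  show "\<phi> x = 0" using assms(2) closure_subset[of "{x. \<phi> x \<noteq> 0}"] by auto
  have "(\<phi> has_derivative (\<lambda>h. 0)) (at x)"
  \<comment> \<open>The complement of the support is open, so the function vanishes in a whole
    neighbourhood of x.\<close>
  proof (rule has_derivative_transform_within_open[where f = "\<lambda>x. 0" and s = "- closure {x. \<phi> x \<noteq> 0}"])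
    show "0 = \<phi> y" if "y \<in> - closure {x. \<phi> x \<noteq> 0}" for y
      using that closure_subset[of "{x. \<phi> x \<noteq> 0}"] by auto
  qed (use assms(2) in auto)
  then show "frechet_derivative \<phi> (at x) = (\<lambda>h. 0)"
    by (simp add: frechet_derivative_at[symmetric])
qed

section \<open>Integrals of test functions and of their derivatives\<close>

lemma directional_derivative:
  fixes \<phi> :: "real ^ 'n \<Rightarrow> real"
  assumes "(\<phi> has_derivative frechet_derivative \<phi> (at (x + s *\<^sub>R e))) (at (x + s *\<^sub>R e))"
  shows "((\<lambda>t. \<phi> (x + t *\<^sub>R e)) has_real_derivative frechet_derivative \<phi> (at (x + s *\<^sub>R e)) e) (at s)"
proof -
  have "((\<lambda>t. x + t *\<^sub>R e) has_derivative (\<lambda>t. t *\<^sub>R e)) (at s)"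
    by (auto intro!: derivative_eq_intros)
  then have "((\<lambda>t. \<phi> (x + t *\<^sub>R e)) has_derivative
      (\<lambda>t. frechet_derivative \<phi> (at (x + s *\<^sub>R e)) (t *\<^sub>R e))) (at s)"
    using assms by (rule has_derivative_compose)
  moreover have "frechet_derivative \<phi> (at (x + s *\<^sub>R e)) (t *\<^sub>R e) =
      frechet_derivative \<phi> (at (x + s *\<^sub>R e)) e * t" for t
    using has_derivative_linear[OF assms] by (simp add: linear_cmul)
  ultimately show ?thesis by (simp add: has_field_derivative_def)
qed

lemma bounded_compact_support:
  fixes f :: "'a::topological_space \<Rightarrow> real"
  assumes "continuous_on UNIV f" "compact K" "\<And>x. x \<notin> K \<Longrightarrow> f x = 0"
  shows "\<exists>B. \<forall>x. \<bar>f x\<bar> \<le> B"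
proof -
  have "bounded (f ` K)"
    using assms(1,2) by (intro compact_imp_bounded compact_continuous_image) (auto intro: continuous_on_subset)
  then obtain B where B: "B > 0" "\<And>x. x \<in> K \<Longrightarrow> \<bar>f x\<bar> \<le> B"
    unfolding bounded_pos by auto
  have "\<bar>f x\<bar> \<le> B" for x
    using B assms(3)[of x] by (cases "x \<in> K") auto
  then show ?thesis by blast
qed

lemma test_function_bounded:
  assumes "\<phi> \<in> test_functions \<Omega>"
  shows "\<exists>B. \<forall>x. \<bar>\<phi> x\<bar> \<le> B" "\<exists>B. \<forall>x. \<bar>frechet_derivative \<phi> (at x) (axis j 1)\<bar> \<le> B"
proof -
  have K: "compact (closure {x. \<phi> x \<noteq> 0})"
    using assms by (simp add: test_functions_def)
  show "\<exists>B. \<forall>x. \<bar>\<phi> x\<bar> \<le> B"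
    using test_function_outside(1)[OF assms]
    by (intro bounded_compact_support[OF test_function_partial(2)[OF assms] K])
  show "\<exists>B. \<forall>x. \<bar>frechet_derivative \<phi> (at x) (axis j 1)\<bar> \<le> B"
    using test_function_outside(2)[OF assms]
    by (intro bounded_compact_support[OF test_function_partial(3)[OF assms] K]) metis
qed

lemma integrable_bounded_scaleR:
  fixes g :: "real ^ 'n \<Rightarrow> 'b::euclidean_space"
  assumes "integrable (lebesgue_on \<Omega>) g" "continuous_on UNIV f" "\<And>x. \<bar>f x\<bar> \<le> B"
  shows "integrable (lebesgue_on \<Omega>) (\<lambda>x. f x *\<^sub>R g x)"
proof (rule Bochner_Integration.integrable_bound)
  show "integrable (lebesgue_on \<Omega>) (\<lambda>x. B *\<^sub>R g x)" using assms(1) by simp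
  have [measurable]: "f \<in> borel_measurable (lebesgue_on \<Omega>)"
    using assms(2) by (intro measurable_restrict_space1 measurable_completion) (simp add: borel_measurable_continuous_onI)
  have [measurable]: "g \<in> borel_measurable (lebesgue_on \<Omega>)" using assms(1) by simp
  show "(\<lambda>x. f x *\<^sub>R g x) \<in> borel_measurable (lebesgue_on \<Omega>)" by measurable
  show "AE x in lebesgue_on \<Omega>. norm (f x *\<^sub>R g x) \<le> norm (B *\<^sub>R g x)"
  proof (rule AE_I2)
    fix x
    have "\<bar>f x\<bar> \<le> \<bar>B\<bar>" using assms(3)[of x] by linarith
    then show "norm (f x *\<^sub>R g x) \<le> norm (B *\<^sub>R g x)" by (simp add: mult_right_mono)
  qed
qed

lemma test_function_integrable:
  fixes g :: "real ^ 'n \<Rightarrow> 'b::euclidean_space"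
  assumes "\<phi> \<in> test_functions \<Omega>'" "integrable (lebesgue_on \<Omega>) g"
  shows "integrable (lebesgue_on \<Omega>) (\<lambda>x. \<phi> x *\<^sub>R g x)"
    and "integrable (lebesgue_on \<Omega>) (\<lambda>x. frechet_derivative \<phi> (at x) (axis j 1) *\<^sub>R g x)"
proof -
  show "integrable (lebesgue_on \<Omega>) (\<lambda>x. \<phi> x *\<^sub>R g x)"
    using test_function_bounded(1)[OF assms(1)] integrable_bounded_scaleR[OF assms(2) test_function_partial(2)[OF assms(1)]] by blast
  show "integrable (lebesgue_on \<Omega>) (\<lambda>x. frechet_derivative \<phi> (at x) (axis j 1) *\<^sub>R g x)"
    using test_function_bounded(2)[OF assms(1), of j] integrable_bounded_scaleR[OF assms(2) test_function_partial(3)[OF assms(1)]]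
    by blast
qed

text \<open>By translation invariance the difference quotients of \<open>\<phi>\<close> have integral 0.\<close>

lemma integral_partial_test_function:
  fixes \<Omega> :: "(real ^ 'n) set"
  assumes "open \<Omega>" and \<phi>: "\<phi> \<in> test_functions \<Omega>"
  shows "(LINT x|lebesgue_on \<Omega>. frechet_derivative \<phi> (at x) (axis j 1)) = 0"
proof -
  let ?K = "closure {x. \<phi> x \<noteq> 0}" and ?e = "axis j 1 :: real ^ 'n"
  let ?d = "\<lambda>x. frechet_derivative \<phi> (at x) ?e"
  have \<Omega>: "\<Omega> \<in> sets lebesgue" using assms(1) by auto
  have K: "compact ?K" "?K \<subseteq> \<Omega>" using \<phi> by (auto simp: test_functions_def)
  obtain B where B: "\<And>x. \<bar>?d x\<bar> \<le> B"
    using test_function_bounded(2)[OF \<phi>, of j] by blast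
  obtain R where R: "?K \<subseteq> cball 0 R"
    using compact_imp_bounded[OF K(1)] by (auto simp: bounded_iff subset_iff)
  define q where "q k x = real (Suc k) * (\<phi> (x + inverse (real (Suc k)) *\<^sub>R ?e) - \<phi> x)" for k x
  have \<phi>_lborel: "integrable lborel \<phi>"
  proof -
    have "integrable lborel (\<lambda>x. indicator ?K x *\<^sub>R \<phi> x)"
      using K(1) test_function_partial(2)[OF \<phi>]
      by (intro borel_integrable_compact) (auto intro: continuous_on_subset)
    moreover have "indicator ?K x *\<^sub>R \<phi> x = \<phi> x" for x
      using test_function_outside(1)[OF \<phi>, of x] by (cases "x \<in> ?K") auto
    ultimately show ?thesis by (simp only:)
  qed
  have shift: "integrable lborel (\<lambda>x. \<phi> (x + t))" "(LINT x|lborel. \<phi> (x + t)) = (LINT x|lborel. \<phi> x)" for t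
  proof -
    have D: "lborel = distr lborel borel (\<lambda>x. t + x)" by (simp add: lborel_distr_plus)
    have [measurable]: "\<phi> \<in> borel_measurable borel"
      using test_function_partial(2)[OF \<phi>] by (rule borel_measurable_continuous_onI)
    have "integrable (distr lborel borel (\<lambda>x. t + x)) \<phi>" using \<phi>_lborel D by simp
    then show "integrable lborel (\<lambda>x. \<phi> (x + t))"
      by (subst (asm) integrable_distr_eq) (auto simp: add.commute)
    have "(LINT x|lborel. \<phi> x) = (LINT x|distr lborel borel (\<lambda>x. t + x). \<phi> x)" using D by simp
    also have "\<dots> = (LINT x|lborel. \<phi> (x + t))"
      by (subst integral_distr) (auto simp: add.commute)
    finally show "(LINT x|lborel. \<phi> (x + t)) = (LINT x|lborel. \<phi> x)" ..
  qed
  have q0: "(LINT x|lborel. q k x) = 0" for k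
    unfolding q_def using shift \<phi>_lborel by (simp del: of_nat_Suc)
  have lim: "(\<lambda>k. q k x) \<longlonglongrightarrow> ?d x" for x
  proof -
    have "((\<lambda>t. \<phi> (x + t *\<^sub>R ?e)) has_real_derivative ?d x) (at 0)"
      using directional_derivative[where s = 0 and e = ?e, OF test_function_partial(1)[OF \<phi>], of x] by simp
    then have "((\<lambda>h. (\<phi> (x + h *\<^sub>R ?e) - \<phi> x) / h) \<longlongrightarrow> ?d x) (at 0)"
      by (simp add: DERIV_def)
    moreover have "filterlim (\<lambda>k. inverse (real (Suc k))) (at 0) sequentially"
      using LIMSEQ_inverse_real_of_nat by (auto simp: filterlim_at)
    ultimately have "(\<lambda>k. (\<phi> (x + inverse (real (Suc k)) *\<^sub>R ?e) - \<phi> x) / inverse (real (Suc k))) \<longlonglongrightarrow> ?d x"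
      by (rule filterlim_compose)
    then show ?thesis by (simp add: q_def divide_inverse ac_simps del: of_nat_Suc)
  qed
  \<comment> \<open>The mean value theorem turns the quotient into a value of the derivative,
    bounded by B. The step is at most 1, so the quotient vanishes outside the ball enlarged by 1,
    and the majorant is integrable.\<close>
  have bound: "\<bar>q k x\<bar> \<le> B * indicator (cball 0 (R + 1)) x" for k x
  proof (cases "x \<in> cball 0 (R + 1)")
    case True
    have "\<exists>z. \<phi> (x + t *\<^sub>R ?e) - \<phi> x = ?d z * t" if "t > 0" for t
    proof -
      have "((\<lambda>t. \<phi> (x + t *\<^sub>R ?e)) has_real_derivative ?d (x + s *\<^sub>R ?e)) (at s)" for s
        by (rule directional_derivative[OF test_function_partial(1)[OF \<phi>]])
      from MVT2[OF that this] show ?thesis by (auto simp: ac_simps)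
    qed
    then obtain z where "\<phi> (x + inverse (real (Suc k)) *\<^sub>R ?e) - \<phi> x = ?d z * inverse (real (Suc k))"
      by (metis inverse_positive_iff_positive of_nat_0_less_iff zero_less_Suc)
    then have "q k x = ?d z" by (simp add: q_def field_simps)
    then show ?thesis using B True by simp
  next
    case False
    have "norm (x + inverse (real (Suc k)) *\<^sub>R ?e) \<ge> norm x - inverse (real (Suc k))"
      using norm_triangle_ineq2[of x "- inverse (real (Suc k)) *\<^sub>R ?e"] by (simp del: of_nat_Suc)
    moreover have "inverse (real (Suc k)) \<le> 1" by (simp add: inverse_le_1_iff)
    ultimately have "x + inverse (real (Suc k)) *\<^sub>R ?e \<notin> cball 0 R" "x \<notin> cball 0 R"
      using False by (auto simp del: of_nat_Suc)
    then have "x + inverse (real (Suc k)) *\<^sub>R ?e \<notin> ?K" "x \<notin> ?K"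
      using R by blast+
    then have "\<phi> (x + inverse (real (Suc k)) *\<^sub>R ?e) = 0" "\<phi> x = 0"
      using test_function_outside(1)[OF \<phi>] by blast+
    then show ?thesis
      using False by (simp add: q_def)
  qed
  have meas: "?d \<in> borel_measurable borel"
    using test_function_partial(3)[OF \<phi>] by (rule borel_measurable_continuous_onI)
  have "(\<lambda>k. LINT x|lborel. q k x) \<longlonglongrightarrow> (LINT x|lborel. ?d x)"
  proof (rule integral_dominated_convergence[where w = "\<lambda>x. B * indicator (cball 0 (R + 1)) x"])
    show "integrable lborel (\<lambda>x. B * indicator (cball (0 :: real ^ 'n) (R + 1)) x)"
      by (intro integrable_mult_right integrable_real_indicator emeasure_compact_finite) (auto intro: emeasure_compact_finite)
    show "q k \<in> borel_measurable lborel" for k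
      unfolding q_def using shift(1) \<phi>_lborel
      by (intro borel_measurable_integrable integrable_mult_right Bochner_Integration.integrable_diff) auto
  qed (use lim bound meas in auto)
  then have "(LINT x|lborel. ?d x) = 0"
    using LIMSEQ_unique[OF _ tendsto_const] by (simp add: q0)
  moreover have "(LINT x|lborel. ?d x) = (LINT x|lebesgue. ?d x)"
    using meas by (simp add: integral_completion)
  moreover have "(LINT x|lebesgue. ?d x) = (LINT x|lebesgue_on \<Omega>. ?d x)"
  proof -
    have "indicator \<Omega> x *\<^sub>R ?d x = ?d x" for x
    proof (cases "x \<in> \<Omega>")
      case False
      then have "x \<notin> ?K" using K(2) by blast
      then show ?thesis using test_function_outside(2)[OF \<phi>] by simp
    qed simp
    then have "(LINT x|lebesgue. ?d x) = (LINT x|lebesgue. indicator \<Omega> x *\<^sub>R ?d x)" by (simp only:)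
    then show ?thesis using \<Omega> by (subst integral_restrict_space) auto
  qed
  ultimately show ?thesis by simp
qed

section \<open>Square integrable functions and weak Jacobians\<close>

lemma square_integrable_diff:
  assumes "square_integrable M f" "square_integrable M g"
  shows "square_integrable M (\<lambda>x. f x - g x)"
proof -
  have [measurable]: "f \<in> borel_measurable M" "g \<in> borel_measurable M"
    using assms by (auto simp: square_integrable_def)
  have "integrable M (\<lambda>x. (norm (f x - g x))\<^sup>2)"
  proof (rule Bochner_Integration.integrable_bound)
    show "integrable M (\<lambda>x. 2 * (norm (f x))\<^sup>2 + 2 * (norm (g x))\<^sup>2)"
      using assms by (auto simp: square_integrable_def)
    \<comment> \<open>The two sides differ by |f x + g x|^2.\<close>
    have "(norm (f x - g x))\<^sup>2 \<le> 2 * (norm (f x))\<^sup>2 + 2 * (norm (g x))\<^sup>2" for x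
      using zero_le_power2[of "norm (f x + g x)"] by (simp add: power2_norm_eq_inner algebra_simps)
    then show "AE x in M. norm ((norm (f x - g x))\<^sup>2) \<le> norm (2 * (norm (f x))\<^sup>2 + 2 * (norm (g x))\<^sup>2)"
      by (intro AE_I2) simp
  qed measurable
  then show ?thesis by (simp add: square_integrable_def)
qed

lemma square_integrable_inner:
  assumes "square_integrable M f" "square_integrable M g"
  shows "integrable M (\<lambda>x. f x \<bullet> g x)"
proof (rule Bochner_Integration.integrable_bound)
  show "integrable M (\<lambda>x. (norm (f x))\<^sup>2 + (norm (g x))\<^sup>2)"
    using assms by (auto simp: square_integrable_def)
  have "\<bar>f x \<bullet> g x\<bar> \<le> (norm (f x))\<^sup>2 + (norm (g x))\<^sup>2" for x
  proof -
    have "\<bar>f x \<bullet> g x\<bar> \<le> norm (f x) * norm (g x)" by (rule Cauchy_Schwarz_ineq2)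
    also have "\<dots> \<le> (norm (f x))\<^sup>2 + (norm (g x))\<^sup>2"
      using sum_squares_bound[of "norm (f x)" "norm (g x)"]
        mult_nonneg_nonneg[OF norm_ge_zero norm_ge_zero, of "f x" "g x"] by linarith
    finally show ?thesis .
  qed
  then show "AE x in M. norm (f x \<bullet> g x) \<le> norm ((norm (f x))\<^sup>2 + (norm (g x))\<^sup>2)"
    by (intro AE_I2) simp
  have [measurable]: "f \<in> borel_measurable M" "g \<in> borel_measurable M"
    using assms by (auto simp: square_integrable_def)
  show "(\<lambda>x. f x \<bullet> g x) \<in> borel_measurable M" by measurable
qed

lemma square_integrable_AE_cong:
  assumes "square_integrable M f" "AE x in M. f x = g x" "g \<in> borel_measurable M"
  shows "square_integrable M g"
proof -
  have [measurable]: "f \<in> borel_measurable M" "g \<in> borel_measurable M"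
    using assms by (auto simp: square_integrable_def)
  have "integrable M (\<lambda>x. (norm (f x))\<^sup>2) \<longleftrightarrow> integrable M (\<lambda>x. (norm (g x))\<^sup>2)"
    using assms(2) by (intro integrable_cong_AE) auto
  then show ?thesis using assms by (simp add: square_integrable_def)
qed

text \<open>The hypothesis on h is only almost everywhere because strain, divergence and trace of a
  difference are determined only up to null sets.\<close>

lemma square_integrable_diff_expansion:
  assumes f: "square_integrable M f" and g: "square_integrable M g"
    and h: "h \<in> borel_measurable M" "AE x in M. h x = f x - g x"
  shows "(LINT x|M. h x \<bullet> h x) =
    (LINT x|M. f x \<bullet> f x) - 2 * (LINT x|M. f x \<bullet> g x) + (LINT x|M. g x \<bullet> g x)"
proof -
  have [measurable]: "f \<in> borel_measurable M" "g \<in> borel_measurable M"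
    using assms by (auto simp: square_integrable_def)
  have "(LINT x|M. h x \<bullet> h x) = (LINT x|M. f x \<bullet> f x - 2 * (f x \<bullet> g x) + g x \<bullet> g x)"
    using h(2) by (intro integral_cong_AE)
      (use h(1) in \<open>auto simp: inner_diff_left inner_diff_right inner_commute\<close>)
  also have "\<dots> = (LINT x|M. f x \<bullet> f x) - 2 * (LINT x|M. f x \<bullet> g x) + (LINT x|M. g x \<bullet> g x)"
    using square_integrable_inner[OF f f] square_integrable_inner[OF f g] square_integrable_inner[OF g g]
    by simp
  finally show ?thesis .
qed

lemma square_integrable_bounded_linear:
  assumes "square_integrable M f" "bounded_linear L"
  shows "square_integrable M (\<lambda>x. L (f x))"
proof -
  have [measurable]: "f \<in> borel_measurable M"
    using assms by (auto simp: square_integrable_def)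
  have "continuous_on UNIV L"
    using assms(2) by (simp add: linear_continuous_on)
  then have [measurable]: "L \<in> borel_measurable borel"
    by (rule borel_measurable_continuous_onI)
  obtain K where K: "\<And>y. norm (L y) \<le> norm y * K"
    using bounded_linear.bounded[OF assms(2)] by blast
  have "integrable M (\<lambda>x. (norm (L (f x)))\<^sup>2)"
  proof (rule Bochner_Integration.integrable_bound)
    show "integrable M (\<lambda>x. K\<^sup>2 * (norm (f x))\<^sup>2)"
      using assms by (auto simp: square_integrable_def)
    have "(norm (L (f x)))\<^sup>2 \<le> K\<^sup>2 * (norm (f x))\<^sup>2" for x
      using power_mono[OF K[of "f x"], of 2] by (simp add: power_mult_distrib mult.commute)
    then show "AE x in M. norm ((norm (L (f x)))\<^sup>2) \<le> norm (K\<^sup>2 * (norm (f x))\<^sup>2)"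
      by (intro AE_I2) simp
  qed measurable
  then show ?thesis by (simp add: square_integrable_def)
qed

lemma square_integrable_imp_integrable:
  assumes "finite_measure M" "square_integrable M f"
  shows "integrable M f"
proof (rule Bochner_Integration.integrable_bound)
  interpret finite_measure M by fact
  show "integrable M (\<lambda>x. 1 + (norm (f x))\<^sup>2)"
    using assms(2) by (auto simp: square_integrable_def)
  have "norm (f x) \<le> 1 + (norm (f x))\<^sup>2" for x
    using sum_squares_bound[of "norm (f x)" 1] norm_ge_zero[of "f x"]
    unfolding one_power2 mult_1_right by linarith
  then show "AE x in M. norm (f x) \<le> norm (1 + (norm (f x))\<^sup>2)"
    by (intro AE_I2) simp
qed (use assms(2) in \<open>simp add: square_integrable_def\<close>)

lemma finite_measure_lebesgue_on_domain:
  "open \<Omega> \<Longrightarrow> bounded \<Omega> \<Longrightarrow> finite_measure (lebesgue_on \<Omega>)" for \<Omega> :: "(real ^ 'n) set"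
  by (intro finite_measure_lebesgue_on bounded_set_imp_lmeasurable) auto

section \<open>Weak Jacobians: differences and uniqueness almost everywhere\<close>

lemma is_weak_jacobian_diff:
  fixes v w :: "real ^ 'n \<Rightarrow> real ^ 'm"
  assumes "is_weak_jacobian \<Omega> v G" "is_weak_jacobian \<Omega> w H"
    and int: "integrable (lebesgue_on \<Omega>) v" "integrable (lebesgue_on \<Omega>) w"
      "integrable (lebesgue_on \<Omega>) G" "integrable (lebesgue_on \<Omega>) H"
  shows "is_weak_jacobian \<Omega> (\<lambda>x. v x - w x) (\<lambda>x. G x - H x)"
  unfolding is_weak_jacobian_def
proof (intro ballI allI)
  fix \<phi> :: "real ^ 'n \<Rightarrow> real" and j assume \<phi>: "\<phi> \<in> test_functions \<Omega>"
  have lin: "bounded_linear (column j :: real ^ 'n ^ 'm \<Rightarrow> real ^ 'm)"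
    by (intro linear_conv_bounded_linear[THEN iffD1] linearI) (auto simp: column_def vec_eq_iff)
  \<comment> \<open>Integrability of all four products licenses splitting both integrals.\<close>
  note test_function_integrable(1)[OF \<phi> integrable_bounded_linear[OF lin int(3)]]
    test_function_integrable(1)[OF \<phi> integrable_bounded_linear[OF lin int(4)]]
    test_function_integrable(2)[OF \<phi> int(1), of j] test_function_integrable(2)[OF \<phi> int(2), of j]
  moreover have "column j (G x - H x) = column j (G x) - column j (H x)" for x
    by (simp add: column_def vec_eq_iff)
  ultimately show "(LINT x|lebesgue_on \<Omega>. frechet_derivative \<phi> (at x) (axis j 1) *\<^sub>R (v x - w x)) =
      - (LINT x|lebesgue_on \<Omega>. \<phi> x *\<^sub>R column j (G x - H x))"
    using assms(1,2) \<phi> by (simp add: is_weak_jacobian_def scaleR_diff_right)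
qed

text \<open>Against every test function both candidates give the same value, so the fundamental
  lemma applies to each column of their difference.\<close>

lemma is_weak_jacobian_unique:
  fixes v :: "real ^ 'n \<Rightarrow> real ^ 'm"
  assumes "open \<Omega>" "is_weak_jacobian \<Omega> v G" "is_weak_jacobian \<Omega> v H"
    and int: "integrable (lebesgue_on \<Omega>) G" "integrable (lebesgue_on \<Omega>) H"
  shows "AE x in lebesgue_on \<Omega>. G x = H x"
proof -
  have "AE x in lebesgue_on \<Omega>. column j (G x) - column j (H x) = 0" for j
  proof (rule fundamental_lemma_calculus_of_variations[OF assms(1)])
    have lin: "bounded_linear (column j :: real ^ 'n ^ 'm \<Rightarrow> real ^ 'm)"
      by (intro linear_conv_bounded_linear[THEN iffD1] linearI) (auto simp: column_def vec_eq_iff)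
    note col = integrable_bounded_linear[OF lin int(1)] integrable_bounded_linear[OF lin int(2)]
    then show "integrable (lebesgue_on \<Omega>) (\<lambda>x. column j (G x) - column j (H x))" by simp
    fix \<phi> assume \<phi>: "\<phi> \<in> test_functions \<Omega>"
    have "(LINT x|lebesgue_on \<Omega>. frechet_derivative \<phi> (at x) (axis j 1) *\<^sub>R v x) =
        - (LINT x|lebesgue_on \<Omega>. \<phi> x *\<^sub>R column j (G x))"
      using assms(2) \<phi> unfolding is_weak_jacobian_def by blast
    moreover have "(LINT x|lebesgue_on \<Omega>. frechet_derivative \<phi> (at x) (axis j 1) *\<^sub>R v x) =
        - (LINT x|lebesgue_on \<Omega>. \<phi> x *\<^sub>R column j (H x))"
      using assms(3) \<phi> unfolding is_weak_jacobian_def by blast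
    ultimately have "(LINT x|lebesgue_on \<Omega>. \<phi> x *\<^sub>R column j (G x)) = (LINT x|lebesgue_on \<Omega>. \<phi> x *\<^sub>R column j (H x))"
      by simp
    then show "(LINT x|lebesgue_on \<Omega>. \<phi> x *\<^sub>R (column j (G x) - column j (H x))) = 0"
      using test_function_integrable(1)[OF \<phi> col(1)] test_function_integrable(1)[OF \<phi> col(2)]
      by (simp add: scaleR_diff_right)
  qed
  then have "AE x in lebesgue_on \<Omega>. \<forall>j. column j (G x) - column j (H x) = 0"
    by (subst AE_all_countable) auto
  then show ?thesis
    by eventually_elim (auto simp: column_def vec_eq_iff)
qed

context
  fixes \<Omega> :: "(real ^ 'n) set"
  assumes \<Omega>: "open \<Omega>" "bounded \<Omega>"
begin

lemma weak_jacobian: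
  assumes "v \<in> H1 \<Omega>"
  shows "square_integrable (lebesgue_on \<Omega>) (weak_jacobian \<Omega> v)"
    "is_weak_jacobian \<Omega> v (weak_jacobian \<Omega> v)"
    "integrable (lebesgue_on \<Omega>) v" "integrable (lebesgue_on \<Omega>) (weak_jacobian \<Omega> v)"
proof -
  have "\<exists>G. square_integrable (lebesgue_on \<Omega>) G \<and> is_weak_jacobian \<Omega> v G"
    using assms by (auto simp: H1_def)
  from someI_ex[OF this] show *: "square_integrable (lebesgue_on \<Omega>) (weak_jacobian \<Omega> v)"
    "is_weak_jacobian \<Omega> v (weak_jacobian \<Omega> v)"
    by (auto simp: weak_jacobian_def)
  note L1 = square_integrable_imp_integrable[OF finite_measure_lebesgue_on_domain[OF \<Omega>]]
  show "integrable (lebesgue_on \<Omega>) (weak_jacobian \<Omega> v)" using *(1) by (rule L1)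
  show "integrable (lebesgue_on \<Omega>) v" using assms by (intro L1) (auto simp: H1_def)
qed

text \<open>The Jacobian chosen for the difference need not be the difference of the chosen ones;
  uniqueness identifies them off a null set.\<close>

lemma H1_diff:
  assumes "v \<in> H1 \<Omega>" "w \<in> H1 \<Omega>"
  shows "(\<lambda>x. v x - w x) \<in> H1 \<Omega>"
    and "AE x in lebesgue_on \<Omega>. weak_jacobian \<Omega> (\<lambda>x. v x - w x) x = weak_jacobian \<Omega> v x - weak_jacobian \<Omega> w x"
proof -
  note J = weak_jacobian[OF assms(1)] weak_jacobian[OF assms(2)]
  have jac: "is_weak_jacobian \<Omega> (\<lambda>x. v x - w x) (\<lambda>x. weak_jacobian \<Omega> v x - weak_jacobian \<Omega> w x)"
    by (intro is_weak_jacobian_diff J)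
  moreover have "square_integrable (lebesgue_on \<Omega>) (\<lambda>x. weak_jacobian \<Omega> v x - weak_jacobian \<Omega> w x)"
    "square_integrable (lebesgue_on \<Omega>) (\<lambda>x. v x - w x)"
    using assms J by (auto intro!: square_integrable_diff simp: H1_def)
  ultimately show H1: "(\<lambda>x. v x - w x) \<in> H1 \<Omega>"
    unfolding H1_def by blast
  show "AE x in lebesgue_on \<Omega>. weak_jacobian \<Omega> (\<lambda>x. v x - w x) x = weak_jacobian \<Omega> v x - weak_jacobian \<Omega> w x"
    by (rule is_weak_jacobian_unique[OF \<Omega>(1) weak_jacobian(2)[OF H1] jac])
      (use J weak_jacobian[OF H1] in auto)
qed

text \<open>Supplies the functions whose traces bound the mass of the boundary. The weak Jacobian is
  0 because partial derivatives of test functions integrate to 0.\<close>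

lemma const_in_H1: "(\<lambda>x. c) \<in> H1 \<Omega>" for c :: "real ^ 'm"
proof -
  interpret finite_measure "lebesgue_on \<Omega>"
    using \<Omega> by (rule finite_measure_lebesgue_on_domain)
  have "is_weak_jacobian \<Omega> (\<lambda>x. c) (\<lambda>x. 0)"
    unfolding is_weak_jacobian_def
  proof (intro ballI allI)
    fix \<phi> :: "real ^ 'n \<Rightarrow> real" and j assume \<phi>: "\<phi> \<in> test_functions \<Omega>"
    have "integrable (lebesgue_on \<Omega>) (\<lambda>x. frechet_derivative \<phi> (at x) (axis j 1) *\<^sub>R (1 :: real))"
      by (intro test_function_integrable[OF \<phi>] integrable_const)
    then have "(LINT x|lebesgue_on \<Omega>. frechet_derivative \<phi> (at x) (axis j 1) *\<^sub>R c) = 0"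
      using integral_partial_test_function[OF \<Omega>(1) \<phi>, of j] by (subst integral_scaleR_left) auto
    moreover have "column j 0 = (0 :: real ^ 'm)" by (simp add: column_def vec_eq_iff)
    ultimately show "(LINT x|lebesgue_on \<Omega>. frechet_derivative \<phi> (at x) (axis j 1) *\<^sub>R c) =
        - (LINT x|lebesgue_on \<Omega>. \<phi> x *\<^sub>R column j (0 :: real ^ 'n ^ 'm))"
      by simp
  qed
  moreover have "square_integrable (lebesgue_on \<Omega>) (\<lambda>x. c)" "square_integrable (lebesgue_on \<Omega>) (\<lambda>x. 0 :: real ^ 'n ^ 'm)"
    by (auto simp: square_integrable_def)
  ultimately show ?thesis unfolding H1_def by blast
qed

end

section \<open>Boundary terms\<close>

text \<open>Tonelli writes the integral of |f| over the restricted product as an iterated integral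
  with two indicators, dominated by the integral over the full product.\<close>

lemma integrable_pair_restrict_space:
  fixes f :: "'a \<times> 'a \<Rightarrow> real"
  assumes M: "finite_measure M" and A: "A \<in> sets M" and f: "integrable (M \<Otimes>\<^sub>M M) f"
  shows "integrable (restrict_space M A \<Otimes>\<^sub>M restrict_space M A) f"
proof -
  let ?N = "restrict_space M A"
  interpret M: finite_measure M by fact
  interpret N: finite_measure ?N by (rule finite_measure_restrict_space[OF M A])
  have A': "A \<inter> space M \<in> sets M" using A sets.sets_into_space[OF A] by (simp add: Int_absorb2)
  have id: "(\<lambda>z. z) \<in> measurable (?N \<Otimes>\<^sub>M ?N) (M \<Otimes>\<^sub>M M)"
    by (intro measurable_pair)
      (auto simp: comp_def intro!: measurable_compose[OF measurable_fst] measurable_compose[OF measurable_snd]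
        measurable_restrict_space1)
  have meas: "g \<in> borel_measurable (?N \<Otimes>\<^sub>M ?N)"
    if "g \<in> borel_measurable (M \<Otimes>\<^sub>M M)" for g :: "'a \<times> 'a \<Rightarrow> ennreal"
    using measurable_compose[OF id that] .
  have fN: "f \<in> borel_measurable (?N \<Otimes>\<^sub>M ?N)"
    using measurable_compose[OF id borel_measurable_integrable[OF f]] .
  let ?g = "\<lambda>z. ennreal (norm (f z))"
  have g: "?g \<in> borel_measurable (M \<Otimes>\<^sub>M M)" using f by simp
  have "(\<integral>\<^sup>+ z. ?g z \<partial>(?N \<Otimes>\<^sub>M ?N)) = (\<integral>\<^sup>+ x. \<integral>\<^sup>+ y. ?g (x, y) \<partial>?N \<partial>?N)"
    by (rule N.nn_integral_fst[OF meas[OF g], symmetric])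
  also have "\<dots> = (\<integral>\<^sup>+ x. (\<integral>\<^sup>+ y. ?g (x, y) * indicator A y \<partial>M) * indicator A x \<partial>M)"
    using A' by (simp add: nn_integral_restrict_space)
  also have "\<dots> \<le> (\<integral>\<^sup>+ x. \<integral>\<^sup>+ y. ?g (x, y) \<partial>M \<partial>M)"
    by (auto intro!: nn_integral_mono simp: indicator_def)
  also have "\<dots> = (\<integral>\<^sup>+ z. ?g z \<partial>(M \<Otimes>\<^sub>M M))"
    by (rule M.nn_integral_fst[OF g])
  also have "\<dots> < \<infinity>" using f by (simp add: integrable_iff_bounded)
  finally show ?thesis using fN by (simp add: integrable_iff_bounded)
qed

section \<open>Comparison of the geodesic and the Euclidean kernel\<close>

lemma dist_le_curve_length: "ennreal (dist (g 0) (g 1)) \<le> curve_length g"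
proof -
  have "(\<Sum>i<1::nat. ennreal (dist (g (real i)) (g (real (Suc i))))) \<le> curve_length g"
    unfolding curve_length_def
    \<comment> \<open>The embedding \<open>real\<close> with k = 1 is the partition of [0, 1] that
      has only the end points.\<close>
    by (rule SUP_upper2[of "(1, real)"]) (auto simp: mono_on_def)
  then show ?thesis by simp
qed

lemma dist_le_geodesic_dist: "ennreal (dist x y) \<le> geodesic_dist \<Gamma> x y"
  unfolding geodesic_dist_def
proof (rule INF_greatest)
  fix g assume "g \<in> {g. path g \<and> path_image g \<subseteq> \<Gamma> \<and> pathstart g = x \<and> pathfinish g = y}"
  then show "ennreal (dist x y) \<le> curve_length g"
    using dist_le_curve_length[of g] by (auto simp: pathstart_def pathfinish_def)
qed

lemma half_kernel_nonneg: "0 \<le> half_kernel \<rho> x y"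
  by (simp add: half_kernel_def)

text \<open>The geodesic distance is at least the Euclidean one, so its reciprocal power is smaller.
  Off the diagonal both are positive, and the reciprocals are genuine rather than the convention 1 /
  0 = 0.\<close>

lemma half_kernel_geodesic_le:
  assumes "x \<noteq> y"
  shows "half_kernel (geodesic_dist \<Gamma>) x y \<le> half_kernel euclidean_dist x y"
proof (cases "geodesic_dist \<Gamma> x y = \<infinity>")
  case True
  then show ?thesis by (simp add: half_kernel_def)
next
  case False
  then have "dist x y \<le> enn2real (geodesic_dist \<Gamma> x y)"
    using enn2real_mono[OF dist_le_geodesic_dist[of x y \<Gamma>]] by (simp add: top.not_eq_extremum)
  moreover have "0 < dist x y" using assms by simp
  ultimately have "1 / enn2real (geodesic_dist \<Gamma> x y) ^ CARD('a) \<le> 1 / dist x y ^ CARD('a)"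
    by (intro divide_left_mono power_mono mult_pos_pos zero_less_power) linarith+
  then show ?thesis
    using False by (simp add: half_kernel_def euclidean_dist_def)
qed

lemma half_kernel_measurable:
  assumes "(\<lambda>(x, y). \<rho> x y) \<in> borel_measurable M"
  shows "(\<lambda>z. half_kernel \<rho> (fst z) (snd z)) \<in> borel_measurable M"
proof -
  have [measurable]: "(\<lambda>z. \<rho> (fst z) (snd z)) \<in> borel_measurable M"
    using assms by (simp add: case_prod_beta')
  show ?thesis unfolding half_kernel_def by measurable
qed

lemma surface_measure_restrict:
  fixes \<Gamma> F :: "(real ^ 'n) set"
  assumes "F \<in> sets (hausdorff_measure (CARD('n) - 1))"
    and "\<Gamma> \<subseteq> F" "\<Gamma> \<in> sets (hausdorff_measure (CARD('n) - 1))"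
  shows "\<Gamma> \<in> sets (surface_measure F)"
    and "surface_measure \<Gamma> = restrict_space (surface_measure F) \<Gamma>"
proof -
  show "\<Gamma> \<in> sets (surface_measure F)"
    using assms by (auto simp: surface_measure_def sets_restrict_space)
  show "surface_measure \<Gamma> = restrict_space (surface_measure F) \<Gamma>"
    using assms sets.sets_into_space[OF assms(1)] sets.sets_into_space[OF assms(3)]
    unfolding surface_measure_def
    by (subst restrict_restrict_space) (auto simp: Int_absorb1 Int_absorb2)
qed

text \<open>Passing to a subset and to a larger distance both decrease the double integral, so
  finiteness on the whole boundary survives. Measurability of the smaller integrand comes from
  \<open>geo\<close>.\<close>

lemma H_half_restrict_geodesic:
  assumes F: "finite_measure (surface_measure F)" "F \<in> sets (hausdorff_measure (CARD('n) - 1))"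
    and \<Gamma>: "\<Gamma> \<subseteq> F" "\<Gamma> \<in> sets (hausdorff_measure (CARD('n) - 1))"
    and geo: "(\<lambda>(x, y). geodesic_dist \<Gamma> x y) \<in> borel_measurable (surface_measure \<Gamma> \<Otimes>\<^sub>M surface_measure \<Gamma>)"
    and v: "v \<in> H_half euclidean_dist F"
  shows "(v :: real ^ 'n \<Rightarrow> real ^ 'm) \<in> H_half (geodesic_dist \<Gamma>) \<Gamma>"
proof -
  note \<Gamma>F = surface_measure_restrict(1)[OF F(2) \<Gamma>] and res = surface_measure_restrict(2)[OF F(2) \<Gamma>]
  have sp: "\<Gamma> \<inter> space (surface_measure F) \<in> sets (surface_measure F)"
    using \<Gamma>F sets.sets_into_space[OF \<Gamma>F] by (simp add: Int_absorb2)
  have v_meas: "v \<in> borel_measurable (surface_measure F)"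
    and v_int: "integrable (surface_measure F) (\<lambda>x. (norm (v x))\<^sup>2)"
    using v by (auto simp: H_half_def square_integrable_def)
  have [measurable]: "v \<in> borel_measurable (surface_measure \<Gamma>)"
    using v_meas unfolding res by (rule measurable_restrict_space1)
  have "integrable (surface_measure F) (\<lambda>x. indicator \<Gamma> x *\<^sub>R (norm (v x))\<^sup>2)"
    using v_int \<Gamma>F by (rule integrable_mult_indicator[rotated])
  then have sq: "square_integrable (surface_measure \<Gamma>) v"
    unfolding square_integrable_def using v_int sp by (auto simp: res integrable_restrict_space intro: measurable_restrict_space1[OF v_meas])
  have [measurable]: "(\<lambda>z. half_kernel (geodesic_dist \<Gamma>) (fst z) (snd z))
      \<in> borel_measurable (surface_measure \<Gamma> \<Otimes>\<^sub>M surface_measure \<Gamma>)"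
    by (rule half_kernel_measurable[OF geo])
  have "integrable (surface_measure \<Gamma> \<Otimes>\<^sub>M surface_measure \<Gamma>)
      (\<lambda>(x, y). (norm (v x - v y))\<^sup>2 * half_kernel (geodesic_dist \<Gamma>) x y)"
  proof (rule Bochner_Integration.integrable_bound)
    show "integrable (surface_measure \<Gamma> \<Otimes>\<^sub>M surface_measure \<Gamma>)
        (\<lambda>(x, y). (norm (v x - v y))\<^sup>2 * half_kernel euclidean_dist x y)"
      unfolding res using v by (intro integrable_pair_restrict_space F(1) \<Gamma>F) (simp add: H_half_def)
    show "(\<lambda>(x, y). (norm (v x - v y))\<^sup>2 * half_kernel (geodesic_dist \<Gamma>) x y)
        \<in> borel_measurable (surface_measure \<Gamma> \<Otimes>\<^sub>M surface_measure \<Gamma>)"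
      unfolding case_prod_beta' by measurable
    \<comment> \<open>On the diagonal both sides vanish through the factor v x - v y, so the kernels
      are compared only off it.\<close>
    have "(norm (v x - v y))\<^sup>2 * half_kernel (geodesic_dist \<Gamma>) x y
        \<le> (norm (v x - v y))\<^sup>2 * half_kernel euclidean_dist x y" for x y
      by (cases "x = y") (auto intro!: mult_left_mono half_kernel_geodesic_le)
    then show "AE z in surface_measure \<Gamma> \<Otimes>\<^sub>M surface_measure \<Gamma>.
        norm (case z of (x, y) \<Rightarrow> (norm (v x - v y))\<^sup>2 * half_kernel (geodesic_dist \<Gamma>) x y)
        \<le> norm (case z of (x, y) \<Rightarrow> (norm (v x - v y))\<^sup>2 * half_kernel euclidean_dist x y)"
      by (intro AE_I2) (auto simp: half_kernel_nonneg split: prod.split)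
  qed
  with sq show ?thesis by (simp add: H_half_def)
qed

text \<open>\<open>S f\<close> below is the difference of \<open>f\<close> scaled by the square root of the kernel; it turns the
  double integral into an ordinary \<open>L\<^sup>2\<close> inner product on the product space.\<close>

lemma half_inner_diff_expansion:
  fixes v w h :: "real ^ 'n \<Rightarrow> real ^ 'm"
  assumes fin: "finite_measure (surface_measure \<Gamma>)"
    and \<rho>: "(\<lambda>(x, y). \<rho> x y) \<in> borel_measurable (surface_measure \<Gamma> \<Otimes>\<^sub>M surface_measure \<Gamma>)"
    and v: "v \<in> H_half \<rho> \<Gamma>" and w: "w \<in> H_half \<rho> \<Gamma>"
    and h: "h \<in> borel_measurable (surface_measure \<Gamma>)" "AE x in surface_measure \<Gamma>. h x = v x - w x"
  shows "half_inner \<rho> \<Gamma> h h = half_inner \<rho> \<Gamma> v v - 2 * half_inner \<rho> \<Gamma> v w + half_inner \<rho> \<Gamma> w w"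
proof -
  let ?N = "surface_measure \<Gamma>"
  define S where "S f z = sqrt (half_kernel \<rho> (fst z) (snd z)) *\<^sub>R (f (fst z) - f (snd z))"
    for f :: "real ^ 'n \<Rightarrow> real ^ 'm" and z
  interpret finite_measure ?N by fact
  interpret pair_sigma_finite ?N ?N ..
  have [measurable]: "(\<lambda>z. half_kernel \<rho> (fst z) (snd z)) \<in> borel_measurable (?N \<Otimes>\<^sub>M ?N)"
    by (rule half_kernel_measurable[OF \<rho>])
  have [measurable]: "v \<in> borel_measurable ?N" "w \<in> borel_measurable ?N" "h \<in> borel_measurable ?N"
    using v w h by (auto simp: H_half_def square_integrable_def)
  have S_meas: "S f \<in> borel_measurable (?N \<Otimes>\<^sub>M ?N)" if [measurable]: "f \<in> borel_measurable ?N" for f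
    unfolding S_def by measurable
  have S_inner: "S f z \<bullet> S g z = (case z of (x, y) \<Rightarrow> (f x - f y) \<bullet> (g x - g y) * half_kernel \<rho> x y)" for f g z
    by (simp add: S_def case_prod_beta half_kernel_nonneg mult.assoc[symmetric] flip: real_sqrt_mult)
  have half_inner: "half_inner \<rho> \<Gamma> f g = (LINT x|?N. f x \<bullet> g x) + (LINT z|(?N \<Otimes>\<^sub>M ?N). S f z \<bullet> S g z)" for f g
    by (simp add: half_inner_def S_inner)
  have S_sq: "square_integrable (?N \<Otimes>\<^sub>M ?N) (S f)" if f: "f \<in> H_half \<rho> \<Gamma>" for f
    using f S_meas[of f]
    by (simp add: H_half_def square_integrable_def power2_norm_eq_inner S_inner)
  \<comment> \<open>The null set is used once per variable; sigma-finiteness then carries the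
    iterated statement over to the product measure.\<close>
  have "AE x in ?N. AE y in ?N. h x - h y = (v x - v y) - (w x - w y)"
    using h(2) by eventually_elim (use h(2) in \<open>auto elim: eventually_mono\<close>)
  then have "AE z in (?N \<Otimes>\<^sub>M ?N). h (fst z) - h (snd z) = (v (fst z) - v (snd z)) - (w (fst z) - w (snd z))"
    by (intro AE_pair_measure) simp_all
  then have AE: "AE z in (?N \<Otimes>\<^sub>M ?N). S h z = S v z - S w z"
    by eventually_elim (simp add: S_def flip: scaleR_diff_right)
  have "(LINT z|(?N \<Otimes>\<^sub>M ?N). S h z \<bullet> S h z) = (LINT z|(?N \<Otimes>\<^sub>M ?N). S v z \<bullet> S v z) -
      2 * (LINT z|(?N \<Otimes>\<^sub>M ?N). S v z \<bullet> S w z) + (LINT z|(?N \<Otimes>\<^sub>M ?N). S w z \<bullet> S w z)"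
    by (intro square_integrable_diff_expansion S_sq v w S_meas h AE)
  moreover have "(LINT x|?N. h x \<bullet> h x) = (LINT x|?N. v x \<bullet> v x) -
      2 * (LINT x|?N. v x \<bullet> w x) + (LINT x|?N. w x \<bullet> w x)"
    using v w by (intro square_integrable_diff_expansion h) (auto simp: H_half_def)
  ultimately show ?thesis by (simp add: half_inner)
qed

lemma half_norm_square: "(half_norm \<rho> \<Gamma> v)\<^sup>2 = half_inner \<rho> \<Gamma> v v"
proof -
  have "half_norm \<rho> \<Gamma> v = sqrt (half_inner \<rho> \<Gamma> v v)"
    by (simp add: half_norm_def half_inner_def power2_norm_eq_inner)
  moreover have "0 \<le> half_inner \<rho> \<Gamma> v v"
    unfolding half_inner_def
    by (intro add_nonneg_nonneg Bochner_Integration.integral_nonneg) (auto simp: half_kernel_nonneg)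
  ultimately show ?thesis by simp
qed

lemma half_inner_commute: "half_inner \<rho> \<Gamma> v w = half_inner \<rho> \<Gamma> w v"
  by (simp add: half_inner_def inner_commute)

lemma trace_operator_imp_finite_surface_measure:
  fixes T :: "(real ^ 'n \<Rightarrow> real ^ 'm) \<Rightarrow> (real ^ 'n \<Rightarrow> real ^ 'm)"
  assumes "open \<Omega>" "bounded \<Omega>" and T: "trace_operator \<Omega> T"
  shows "finite_measure (surface_measure (frontier \<Omega>))"
proof -
  let ?M = "surface_measure (frontier \<Omega>)"
  define c :: "real ^ 'm" where "c = (\<chi> i. 1)"
  have H1: "(\<lambda>x. c) \<in> H1 \<Omega>" using assms(1,2) by (rule const_in_H1)
  have "continuous_on (closure \<Omega>) (\<lambda>x. c)" by simp
  with H1 T have "AE x in ?M. T (\<lambda>x. c) x = c" "square_integrable ?M (T (\<lambda>x. c))"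
    unfolding trace_operator_def by (auto simp: H_half_def)
  then have "square_integrable ?M (\<lambda>x. c)"
    by (auto intro: square_integrable_AE_cong)
  \<comment> \<open>Were the total mass infinite, its product with the nonzero number |c|^2 would be
    infinite too.\<close>
  then have "ennreal ((norm c)\<^sup>2) * emeasure ?M (space ?M) < \<infinity>"
    by (simp add: square_integrable_def integrable_iff_bounded)
  moreover have "c \<noteq> 0" by (simp add: c_def vec_eq_iff)
  ultimately have "emeasure ?M (space ?M) \<noteq> \<infinity>"
    by (auto simp: ennreal_mult_top)
  then show ?thesis by (rule finite_measureI)
qed

section \<open>The energy identity\<close>

text \<open>Strain and divergence are this map and \<open>trace_map\<close> applied pointwise to the
  weak Jacobian; as both maps are bounded and linear, square integrability and the rule for
  differences carry over.\<close>

definition strain_map :: "real ^ 'n ^ 'n \<Rightarrow> real ^ 'n ^ 'n" where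
  "strain_map G = (1 / 2) *\<^sub>R (G + transpose G)"

definition trace_map :: "real ^ 'n ^ 'n \<Rightarrow> real" where
  "trace_map G = (\<Sum>i\<in>UNIV. G $ i $ i)"

lemma strain_eq: "strain \<Omega> v = (\<lambda>x. strain_map (weak_jacobian \<Omega> v x))"
  by (simp add: fun_eq_iff strain_def strain_map_def)

lemma divergence_eq: "divergence \<Omega> v = (\<lambda>x. trace_map (weak_jacobian \<Omega> v x))"
  by (simp add: fun_eq_iff divergence_def trace_map_def)

lemma bounded_linear_strain_map: "bounded_linear strain_map"
  by (intro linear_conv_bounded_linear[THEN iffD1] linearI)
    (auto simp: strain_map_def transpose_def vec_eq_iff algebra_simps)

lemma bounded_linear_trace_map: "bounded_linear trace_map"
  by (intro linear_conv_bounded_linear[THEN iffD1] linearI)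
    (auto simp: trace_map_def sum.distrib sum_distrib_left)

lemma square_integrable_strain:
  assumes "open \<Omega>" "bounded \<Omega>" "v \<in> H1 \<Omega>"
  shows "square_integrable (lebesgue_on \<Omega>) (strain \<Omega> v)"
  unfolding strain_eq
  by (rule square_integrable_bounded_linear[OF weak_jacobian(1)[OF assms] bounded_linear_strain_map])

lemma square_integrable_divergence:
  assumes "open \<Omega>" "bounded \<Omega>" "v \<in> H1 \<Omega>"
  shows "square_integrable (lebesgue_on \<Omega>) (divergence \<Omega> v)"
  unfolding divergence_eq
  by (rule square_integrable_bounded_linear[OF weak_jacobian(1)[OF assms] bounded_linear_trace_map])

lemma strain_divergence_diff_AE:
  assumes "open \<Omega>" "bounded \<Omega>" "v \<in> H1 \<Omega>" "w \<in> H1 \<Omega>"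
  shows "AE x in lebesgue_on \<Omega>. strain \<Omega> (\<lambda>x. v x - w x) x = strain \<Omega> v x - strain \<Omega> w x"
    and "AE x in lebesgue_on \<Omega>. divergence \<Omega> (\<lambda>x. v x - w x) x = divergence \<Omega> v x - divergence \<Omega> w x"
  using H1_diff(2)[OF assms]
  by (eventually_elim, simp add: strain_eq divergence_eq
      linear_diff[OF bounded_linear.linear[OF bounded_linear_strain_map]]
      linear_diff[OF bounded_linear.linear[OF bounded_linear_trace_map]])+

text \<open>Writing \<open>v = (v - w) + w\<close> avoids the homogeneity of \<open>T\<close>.\<close>

lemma trace_operator_diff_AE:
  assumes "open \<Omega>" "bounded \<Omega>" "v \<in> H1 \<Omega>" "w \<in> H1 \<Omega>" and T: "trace_operator \<Omega> T"
  shows "AE x in surface_measure (frontier \<Omega>). T (\<lambda>x. v x - w x) x = T v x - T w x"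
proof -
  have add: "\<forall>v\<in>H1 \<Omega>. \<forall>w\<in>H1 \<Omega>. AE x in surface_measure (frontier \<Omega>).
      T (\<lambda>y. v y + w y) x = T v x + T w x"
    using T unfolding trace_operator_def by blast
  have "AE x in surface_measure (frontier \<Omega>).
      T (\<lambda>x. (v x - w x) + w x) x = T (\<lambda>x. v x - w x) x + T w x"
    by (rule add[rule_format, OF H1_diff(1)[OF assms(1-4)] assms(4)])
  then show ?thesis by eventually_elim simp
qed

section \<open>Expansion of the bilinear form and of the energy\<close>

context
  fixes \<Omega> \<Gamma>\<^sub>D :: "(real ^ 'n) set"
    and T :: "(real ^ 'n \<Rightarrow> real ^ 'n) \<Rightarrow> (real ^ 'n \<Rightarrow> real ^ 'n)"
  assumes \<Omega>: "open \<Omega>" "bounded \<Omega>" and T: "trace_operator \<Omega> T"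
    and frontier: "frontier \<Omega> \<in> sets (hausdorff_measure (CARD('n) - 1))"
    and \<Gamma>\<^sub>D: "\<Gamma>\<^sub>D \<subseteq> frontier \<Omega>" "\<Gamma>\<^sub>D \<in> sets (hausdorff_measure (CARD('n) - 1))"
    and geo: "(\<lambda>(x, y). geodesic_dist \<Gamma>\<^sub>D x y)
      \<in> borel_measurable (surface_measure \<Gamma>\<^sub>D \<Otimes>\<^sub>M surface_measure \<Gamma>\<^sub>D)"
begin

lemma finite_surface_measure: "finite_measure (surface_measure \<Gamma>\<^sub>D)"
  unfolding surface_measure_restrict(2)[OF frontier \<Gamma>\<^sub>D]
  by (intro finite_measure_restrict_space trace_operator_imp_finite_surface_measure[OF \<Omega> T]
      surface_measure_restrict(1)[OF frontier \<Gamma>\<^sub>D])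

lemma trace_H_half:
  assumes "v \<in> H1 \<Omega>"
  shows "T v \<in> H_half (geodesic_dist \<Gamma>\<^sub>D) \<Gamma>\<^sub>D"
proof -
  have "T v \<in> H_half euclidean_dist (frontier \<Omega>)"
    using T assms unfolding trace_operator_def by blast
  then show ?thesis
    by (rule H_half_restrict_geodesic[OF trace_operator_imp_finite_surface_measure[OF \<Omega> T] frontier \<Gamma>\<^sub>D geo])
qed

lemma bilinear_a_diff:
  assumes v: "v \<in> H1 \<Omega>" and w: "w \<in> H1 \<Omega>"
  shows "bilinear_a \<Omega> \<Gamma>\<^sub>D T \<mu> lam \<gamma> (\<lambda>x. v x - w x) (\<lambda>x. v x - w x) =
    bilinear_a \<Omega> \<Gamma>\<^sub>D T \<mu> lam \<gamma> v v - 2 * bilinear_a \<Omega> \<Gamma>\<^sub>D T \<mu> lam \<gamma> v w +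
    bilinear_a \<Omega> \<Gamma>\<^sub>D T \<mu> lam \<gamma> w w"
proof -
  let ?d = "\<lambda>x. v x - w x"
  have d: "?d \<in> H1 \<Omega>" by (rule H1_diff(1)[OF \<Omega> v w])
  note sq = square_integrable_strain[OF \<Omega>] square_integrable_divergence[OF \<Omega>]
  have str: "(LINT x|lebesgue_on \<Omega>. strain \<Omega> ?d x \<bullet> strain \<Omega> ?d x) =
      (LINT x|lebesgue_on \<Omega>. strain \<Omega> v x \<bullet> strain \<Omega> v x) -
      2 * (LINT x|lebesgue_on \<Omega>. strain \<Omega> v x \<bullet> strain \<Omega> w x) +
      (LINT x|lebesgue_on \<Omega>. strain \<Omega> w x \<bullet> strain \<Omega> w x)"
    using sq(1)[OF d]
    by (intro square_integrable_diff_expansion sq v w strain_divergence_diff_AE \<Omega>)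
      (simp add: square_integrable_def)
  \<comment> \<open>The product of divergences is written as an inner product of reals, so that the
    same expansion lemma applies.\<close>
  have dvg: "(LINT x|lebesgue_on \<Omega>. divergence \<Omega> ?d x \<bullet> divergence \<Omega> ?d x) =
      (LINT x|lebesgue_on \<Omega>. divergence \<Omega> v x \<bullet> divergence \<Omega> v x) -
      2 * (LINT x|lebesgue_on \<Omega>. divergence \<Omega> v x \<bullet> divergence \<Omega> w x) +
      (LINT x|lebesgue_on \<Omega>. divergence \<Omega> w x \<bullet> divergence \<Omega> w x)"
    using sq(2)[OF d]
    by (intro square_integrable_diff_expansion sq v w strain_divergence_diff_AE \<Omega>)
      (simp add: square_integrable_def)
  have bdr: "half_inner (geodesic_dist \<Gamma>\<^sub>D) \<Gamma>\<^sub>D (T ?d) (T ?d) =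
      half_inner (geodesic_dist \<Gamma>\<^sub>D) \<Gamma>\<^sub>D (T v) (T v) - 2 * half_inner (geodesic_dist \<Gamma>\<^sub>D) \<Gamma>\<^sub>D (T v) (T w) +
      half_inner (geodesic_dist \<Gamma>\<^sub>D) \<Gamma>\<^sub>D (T w) (T w)"
  proof (intro half_inner_diff_expansion finite_surface_measure geo trace_H_half v w)
    show "T ?d \<in> borel_measurable (surface_measure \<Gamma>\<^sub>D)"
      using trace_H_half[OF d] by (simp add: H_half_def square_integrable_def)
    \<comment> \<open>The rule for traces of differences holds off a null set of the whole boundary
      and is restricted to \<open>\<Gamma>\<^sub>D\<close>.\<close>
    have "\<Gamma>\<^sub>D \<inter> space (surface_measure (frontier \<Omega>)) \<in> sets (surface_measure (frontier \<Omega>))"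
      using surface_measure_restrict(1)[OF frontier \<Gamma>\<^sub>D] by blast
    then show "AE x in surface_measure \<Gamma>\<^sub>D. T ?d x = T v x - T w x"
      unfolding surface_measure_restrict(2)[OF frontier \<Gamma>\<^sub>D] using trace_operator_diff_AE[OF \<Omega> v w T]
      by (subst AE_restrict_space_iff) auto
  qed
  show ?thesis
    unfolding bilinear_a_def str dvg[unfolded inner_real_def] bdr by (simp add: algebra_simps)
qed

text \<open>Expanding the boundary penalty produces the boundary part of \<open>a(v, v) / 2\<close>,
  the mixed term that completes the load to \<open>linear_f\<close>, and a remainder that depends on
  the data alone.\<close>

lemma energy_J_eq:
  assumes v: "v \<in> H1 \<Omega>" and g\<^sub>D: "g\<^sub>D \<in> H_half (geodesic_dist \<Gamma>\<^sub>D) \<Gamma>\<^sub>D"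
  shows "energy_J \<Omega> \<Gamma>\<^sub>D T \<mu> lam \<gamma> f g\<^sub>N g\<^sub>D v =
    1 / 2 * bilinear_a \<Omega> \<Gamma>\<^sub>D T \<mu> lam \<gamma> v v - linear_f \<Gamma>\<^sub>D T \<gamma> f g\<^sub>N g\<^sub>D v +
    1 / 2 * \<gamma> * half_inner (geodesic_dist \<Gamma>\<^sub>D) \<Gamma>\<^sub>D g\<^sub>D g\<^sub>D"
proof -
  note sq = square_integrable_strain[OF \<Omega> v] square_integrable_divergence[OF \<Omega> v]
  have "(LINT x|lebesgue_on \<Omega>. 2 * \<mu> * (norm (strain \<Omega> v x))\<^sup>2 + lam * \<bar>divergence \<Omega> v x\<bar>\<^sup>2) =
      (LINT x|lebesgue_on \<Omega>. 2 * \<mu> * (strain \<Omega> v x \<bullet> strain \<Omega> v x) + lam * (divergence \<Omega> v x \<bullet> divergence \<Omega> v x))"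
    by (simp add: power2_norm_eq_inner flip: power2_eq_square)
  also have "\<dots> = 2 * \<mu> * (LINT x|lebesgue_on \<Omega>. strain \<Omega> v x \<bullet> strain \<Omega> v x) +
      lam * (LINT x|lebesgue_on \<Omega>. divergence \<Omega> v x \<bullet> divergence \<Omega> v x)"
    using square_integrable_inner[OF sq(1) sq(1)] square_integrable_inner[OF sq(2) sq(2)]
    by (simp del: inner_real_def)
  finally have bulk: "(LINT x|lebesgue_on \<Omega>. 2 * \<mu> * (norm (strain \<Omega> v x))\<^sup>2 + lam * \<bar>divergence \<Omega> v x\<bar>\<^sup>2) =
      2 * \<mu> * (LINT x|lebesgue_on \<Omega>. strain \<Omega> v x \<bullet> strain \<Omega> v x) +
      lam * (LINT x|lebesgue_on \<Omega>. divergence \<Omega> v x * divergence \<Omega> v x)"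
    by simp
  have bdr: "(half_norm (geodesic_dist \<Gamma>\<^sub>D) \<Gamma>\<^sub>D (\<lambda>x. T v x - g\<^sub>D x))\<^sup>2 =
      half_inner (geodesic_dist \<Gamma>\<^sub>D) \<Gamma>\<^sub>D (T v) (T v) - 2 * half_inner (geodesic_dist \<Gamma>\<^sub>D) \<Gamma>\<^sub>D (T v) g\<^sub>D +
      half_inner (geodesic_dist \<Gamma>\<^sub>D) \<Gamma>\<^sub>D g\<^sub>D g\<^sub>D"
    unfolding half_norm_square
    using trace_H_half[OF v] g\<^sub>D
    by (intro half_inner_diff_expansion finite_surface_measure geo)
      (auto simp: H_half_def square_integrable_def)
  show ?thesis
    unfolding energy_J_def bulk bdr bilinear_a_def linear_f_def half_inner_commute[of _ _ g\<^sub>D "T v"]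
    by (simp add: algebra_simps)
qed

end

section \<open>Best approximation by minimisers of the energy\<close>

theorem theorem1:
  fixes \<Omega> \<Gamma>\<^sub>D \<Gamma>\<^sub>N :: "(real ^ 'n) set"
    and T :: "(real ^ 'n \<Rightarrow> real ^ 'n) \<Rightarrow> (real ^ 'n \<Rightarrow> real ^ 'n)"
    and \<mu> lam \<gamma> \<gamma>\<^sub>D :: real
    and f g\<^sub>N :: "(real ^ 'n \<Rightarrow> real ^ 'n) \<Rightarrow> real"
    and g\<^sub>D u u\<^sub>N :: "real ^ 'n \<Rightarrow> real ^ 'n"
    and \<tau> :: "real \<Rightarrow> real" and l :: nat and n :: "nat \<Rightarrow> nat"
  assumes dim: "CARD('n) \<in> {2, 3}"
    and domain: "bounded_lipschitz_domain \<Omega>"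
    and boundary: "frontier \<Omega> = \<Gamma>\<^sub>D \<union> \<Gamma>\<^sub>N" "\<Gamma>\<^sub>D \<inter> \<Gamma>\<^sub>N = {}"
    and boundary_meas: "\<Gamma>\<^sub>D \<in> sets (hausdorff_measure (CARD('n) - 1))"
      "\<Gamma>\<^sub>N \<in> sets (hausdorff_measure (CARD('n) - 1))"
    and pos_measure: "emeasure (hausdorff_measure (CARD('n) - 1)) \<Gamma>\<^sub>D > 0"
    and geodesic_meas: "(\<lambda>(x, y). geodesic_dist \<Gamma>\<^sub>D x y)
      \<in> borel_measurable (surface_measure \<Gamma>\<^sub>D \<Otimes>\<^sub>M surface_measure \<Gamma>\<^sub>D)"
    and trace: "trace_operator \<Omega> T"
    and parameters: "\<mu> > 0" "2 * \<mu> + real CARD('n) * lam > 0" "\<gamma>\<^sub>D > 0" "\<gamma> = \<mu> * \<gamma>\<^sub>D"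
    and f: "bounded_linear_functional_H1 \<Omega> f"
    and g\<^sub>N: "bounded_linear_functional_H1 \<Omega> (\<lambda>v. g\<^sub>N (T v))"
      "\<And>v w. (AE x in surface_measure \<Gamma>\<^sub>N. v x = w x) \<Longrightarrow> g\<^sub>N v = g\<^sub>N w"
    and g\<^sub>D: "g\<^sub>D \<in> H_half (geodesic_dist \<Gamma>\<^sub>D) \<Gamma>\<^sub>D"
    and layers: "l \<ge> 2" "n 0 = CARD('n)" "n l = CARD('n)"
    and networks: "network_functions \<tau> l n \<subseteq> H1 \<Omega>"
    and u: "u \<in> H1 \<Omega>"
      "\<forall>v\<in>H1 \<Omega>. bilinear_a \<Omega> \<Gamma>\<^sub>D T \<mu> lam \<gamma> u v = linear_f \<Gamma>\<^sub>D T \<gamma> f g\<^sub>N g\<^sub>D v"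
    and u\<^sub>N: "u\<^sub>N \<in> network_functions \<tau> l n"
      "\<forall>v\<in>network_functions \<tau> l n.
         energy_J \<Omega> \<Gamma>\<^sub>D T \<mu> lam \<gamma> f g\<^sub>N g\<^sub>D u\<^sub>N \<le> energy_J \<Omega> \<Gamma>\<^sub>D T \<mu> lam \<gamma> f g\<^sub>N g\<^sub>D v"
  shows "norm_a \<Omega> \<Gamma>\<^sub>D T \<mu> lam \<gamma> (\<lambda>x. u x - u\<^sub>N x) =
    (INF v\<in>network_functions \<tau> l n. norm_a \<Omega> \<Gamma>\<^sub>D T \<mu> lam \<gamma> (\<lambda>x. u x - v x))"
proof -
  let ?a = "bilinear_a \<Omega> \<Gamma>\<^sub>D T \<mu> lam \<gamma>" and ?J = "energy_J \<Omega> \<Gamma>\<^sub>D T \<mu> lam \<gamma> f g\<^sub>N g\<^sub>D"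
  have \<Omega>: "open \<Omega>" "bounded \<Omega>" using domain by (auto simp: bounded_lipschitz_domain_def)
  have frontier: "frontier \<Omega> \<in> sets (hausdorff_measure (CARD('n) - 1))"
    using boundary boundary_meas by auto
  have \<Gamma>\<^sub>D: "\<Gamma>\<^sub>D \<subseteq> frontier \<Omega>" using boundary by auto
  \<comment> \<open>Since u is a solution, a(u - v, u - v) = a(u, u) - 2 f(v) + a(v, v), while 2
    J(v) is a(v, v) - 2 f(v) plus the penalty of \<open>g\<^sub>D\<close> alone; C is the
    difference.\<close>
  define C where "C = ?a u u - \<gamma> * half_inner (geodesic_dist \<Gamma>\<^sub>D) \<Gamma>\<^sub>D g\<^sub>D g\<^sub>D"
  have energy: "?a (\<lambda>x. u x - v x) (\<lambda>x. u x - v x) = 2 * ?J v + C" if v: "v \<in> H1 \<Omega>" for v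
    using bilinear_a_diff[OF \<Omega> trace frontier \<Gamma>\<^sub>D boundary_meas(1) geodesic_meas u(1) v]
      energy_J_eq[OF \<Omega> trace frontier \<Gamma>\<^sub>D boundary_meas(1) geodesic_meas v g\<^sub>D] u(2) v
    by (simp add: C_def)
  have "norm_a \<Omega> \<Gamma>\<^sub>D T \<mu> lam \<gamma> (\<lambda>x. u x - u\<^sub>N x) \<le> norm_a \<Omega> \<Gamma>\<^sub>D T \<mu> lam \<gamma> (\<lambda>x. u x - v x)"
    if "v \<in> network_functions \<tau> l n" for v
  proof -
    have "?J u\<^sub>N \<le> ?J v" using u\<^sub>N(2) that by blast
    moreover have "u\<^sub>N \<in> H1 \<Omega>" "v \<in> H1 \<Omega>" using networks u\<^sub>N(1) that by auto
    \<comment> \<open>Both radicands are 2 J plus the same C, and \<open>sqrt\<close> is monotone on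
      all of the reals.\<close>
    ultimately show ?thesis by (simp add: norm_a_def energy)
  qed
  then show ?thesis
    \<comment> \<open>The lower bound is itself a member of the image, attained at
      \<open>u\<^sub>N\<close>, which settles existence and value of the infimum at once.\<close>
    by (intro cInf_eq_minimum[symmetric] imageI u\<^sub>N(1)) (elim imageE, simp)
qed

end
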